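(* Let $G$ be a countable group. For every IRO $\nu$ on $G$ there is an IRO $\nu'$ on $G$ that is maximal in the extension order and such that $\nu$ is smaller than $\nu'$ in the extension order.
   Context: A partial order on a set is a transitive, antisymmetric ($x\prec y$ implies not $y\prec x$), antireflexive relation. $\mathrm{pOrd}(G)$ is the compact metrizable space of all partial orders on $G$ (a closed subset of $2^{G\times G}$). The R-action of $G$ on $\mathrm{pOrd}(G)$ is given by $x\,(g\prec)\,y$ iff $xg\prec yg$. An invariant random order (IRO) on $G$ is a Borel probability measure on $\mathrm{pOrd}(G)$ invariant under the R-action. Extension order on IROs: $\nu_1$ is smaller than $\nu_2$ (in the non-strict sense) if there is a $G$-invariant (for the diagonal R-action) Borel probability measure on $\mathrm{pOrd}(G)\times\mathrm{pOrd}(G)$ with marginals $\nu_1$ and $\nu_2$ respectively that is supported on the set of pairs $(\prec_1,\prec_2)$ with $\prec_1$ contained in $\prec_2$ (i.e. $x\prec_1 y$ implies $x\prec_2 y$ for all $x,y\in G$). An IRO is extension-maximal if it is maximal for this order, i.e. it is not smaller than any IRO different from itself. *)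

theory Defs
  imports "HOL-Probability.Probability" "HOL-Algebra.Group"
begin

definition strict_orders_on :: "'a set \<Rightarrow> 'a rel set" where
  "strict_orders_on A = {r. r \<subseteq> A \<times> A \<and> trans r \<and> asym r \<and> irrefl r}"

definition pOrd :: "('a, 'b) monoid_scheme \<Rightarrow> 'a rel set" where
  "pOrd G = strict_orders_on (carrier G)"

text \<open>
  The topology is the one induced from the power $2^{G \times G}$ of the discrete two-point space.
  The points of the abstract product space are functions that are extensional outside the index
  set, so a relation is identified with its indicator restricted to pairs of group elements.
\<close>

definition pOrd_topology :: "('a, 'b) monoid_scheme \<Rightarrow> 'a rel topology" where
  "pOrd_topology G =
     pullback_topology (pOrd G) (\<lambda>r. \<lambda>p\<in>carrier G \<times> carrier G. p \<in> r)
       (product_topology (\<lambda>_. discrete_topology (UNIV :: bool set)) (carrier G \<times> carrier G))"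

definition borel_space :: "'a topology \<Rightarrow> 'a measure" where
  "borel_space X = sigma (topspace X) {U. openin X U}"

definition borel_prob :: "'a topology \<Rightarrow> 'a measure \<Rightarrow> bool" where
  "borel_prob X \<mu> \<longleftrightarrow> sets \<mu> = sets (borel_space X) \<and> prob_space \<mu>"

definition r_act :: "('a, 'b) monoid_scheme \<Rightarrow> 'a \<Rightarrow> 'a rel \<Rightarrow> 'a rel" where
  "r_act G g r =
     {(x, y). x \<in> carrier G \<and> y \<in> carrier G \<and> (x \<otimes>\<^bsub>G\<^esub> g, y \<otimes>\<^bsub>G\<^esub> g) \<in> r}"

definition IRO :: "('a, 'b) monoid_scheme \<Rightarrow> 'a rel measure \<Rightarrow> bool" where
  "IRO G \<nu> \<longleftrightarrow> borel_prob (pOrd_topology G) \<nu> \<and>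
     (\<forall>g\<in>carrier G. distr \<nu> (borel_space (pOrd_topology G)) (r_act G g) = \<nu>)"

abbreviation pOrd_pair_topology :: "('a, 'b) monoid_scheme \<Rightarrow> ('a rel \<times> 'a rel) topology" where
  "pOrd_pair_topology G \<equiv> prod_topology (pOrd_topology G) (pOrd_topology G)"

text \<open>
  The set of nested pairs is closed, so being supported on it means being concentrated on it,
  which is expressed by the almost-everywhere quantifier.
\<close>

definition ext_le :: "('a, 'b) monoid_scheme \<Rightarrow> 'a rel measure \<Rightarrow> 'a rel measure \<Rightarrow> bool" where
  "ext_le G \<nu>\<^sub>1 \<nu>\<^sub>2 \<longleftrightarrow> (\<exists>\<mu>. borel_prob (pOrd_pair_topology G) \<mu> \<and>
     (\<forall>g\<in>carrier G.
        distr \<mu> (borel_space (pOrd_pair_topology G)) (map_prod (r_act G g) (r_act G g)) = \<mu>) \<and>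
     distr \<mu> (borel_space (pOrd_topology G)) fst = \<nu>\<^sub>1 \<and>
     distr \<mu> (borel_space (pOrd_topology G)) snd = \<nu>\<^sub>2 \<and>
     (AE (r\<^sub>1, r\<^sub>2) in \<mu>. r\<^sub>1 \<subseteq> r\<^sub>2))"

definition ext_maximal :: "('a, 'b) monoid_scheme \<Rightarrow> 'a rel measure \<Rightarrow> bool" where
  "ext_maximal G \<nu> \<longleftrightarrow> IRO G \<nu> \<and> (\<forall>\<nu>'. IRO G \<nu>' \<and> ext_le G \<nu> \<nu>' \<longrightarrow> \<nu>' = \<nu>)"

text \<open>
  The pushforwards above are meaningful because all the maps involved are continuous, hence
  Borel measurable.
\<close>

lemma topspace_pOrd_topology [simp]: "topspace (pOrd_topology G) = pOrd G"
  by (auto simp: pOrd_topology_def topspace_pullback_topology)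

lemma space_borel_space [simp]: "space (borel_space X) = topspace X"
  by (simp add: borel_space_def space_measure_of_conv)

lemma sets_borel_space: "sets (borel_space X) = sigma_sets (topspace X) {U. openin X U}"
  unfolding borel_space_def by (rule sets_measure_of) (auto dest: openin_subset)

lemma continuous_map_measurable:
  assumes "continuous_map X Y f"
  shows "f \<in> measurable (borel_space X) (borel_space Y)"
proof (rule measurable_sigma_sets[OF sets_borel_space])
  show "{U. openin Y U} \<subseteq> Pow (topspace Y)"
    by (auto dest: openin_subset)
  show "f \<in> space (borel_space X) \<rightarrow> topspace Y"
    using continuous_map_funspace[OF assms] by simp
next
  fix U assume "U \<in> {U. openin Y U}"
  then have "openin X {x \<in> topspace X. f x \<in> U}"
    using assms by (auto simp: continuous_map_def)
  moreover have "f -` U \<inter> space (borel_space X) = {x \<in> topspace X. f x \<in> U}"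
    by auto
  ultimately show "f -` U \<inter> space (borel_space X) \<in> sets (borel_space X)"
    by (auto simp: sets_borel_space)
qed

lemma (in group) r_act_in_pOrd:
  assumes "g \<in> carrier G" "r \<in> pOrd G"
  shows "r_act G g r \<in> pOrd G"
proof -
  have r: "trans r" "asym r" "irrefl r"
    using assms(2) by (auto simp: pOrd_def strict_orders_on_def)
  have "trans (r_act G g r)"
    using r(1) by (auto simp: r_act_def trans_def)
  moreover have "asym (r_act G g r)" "irrefl (r_act G g r)"
    using r(2,3) by (auto simp: r_act_def asym_iff irrefl_def)
  ultimately show ?thesis
    by (auto simp: pOrd_def strict_orders_on_def r_act_def)
qed

lemma (in group) continuous_map_r_act:
  assumes g: "g \<in> carrier G"
  shows "continuous_map (pOrd_topology G) (pOrd_topology G) (r_act G g)"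
proof -
  let ?I = "carrier G \<times> carrier G"
  let ?ind = "\<lambda>r. \<lambda>p\<in>?I. p \<in> r"
  let ?T = "product_topology (\<lambda>_. discrete_topology (UNIV :: bool set)) ?I"
  have ind: "continuous_map (pOrd_topology G) ?T ?ind"
    unfolding pOrd_topology_def
    using continuous_map_pullback[OF continuous_map_id, where A = "pOrd G" and f = ?ind]
    by (simp add: id_def comp_def)
  have coord: "continuous_map (pOrd_topology G) (discrete_topology UNIV) (\<lambda>r. p \<in> r)"
    if "p \<in> ?I" for p
    using continuous_map_componentwise[THEN iffD1, OF ind] that by auto
  have "continuous_map (pOrd_topology G) ?T (?ind \<circ> r_act G g)"
    unfolding continuous_map_componentwise
  proof (intro conjI ballI)
    show "(?ind \<circ> r_act G g) ` topspace (pOrd_topology G) \<subseteq> extensional ?I"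
      by auto
    fix p assume p: "p \<in> ?I"
    have "(fst p \<otimes> g, snd p \<otimes> g) \<in> ?I"
      using p g by auto
    from coord[OF this] show
      "continuous_map (pOrd_topology G) (discrete_topology UNIV) (\<lambda>r. (?ind \<circ> r_act G g) r p)"
      using p by (simp add: r_act_def case_prod_beta mem_Times_iff)
  qed
  then show ?thesis
    unfolding pOrd_topology_def[of G] using r_act_in_pOrd[OF g]
    by (intro continuous_map_pullback')
       (auto simp: pOrd_topology_def[symmetric])
qed

lemma (in group) continuous_map_r_act_pair:
  assumes g: "g \<in> carrier G"
  shows "continuous_map (pOrd_pair_topology G) (pOrd_pair_topology G)
           (map_prod (r_act G g) (r_act G g))"
  using continuous_map_r_act[OF g]
  by (simp add: map_prod_def case_prod_beta continuous_map_prod_top)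

end

theory Submission
  imports Defs
begin

text \<open>
  A joining of two IROs is an invariant measure on pairs of orders concentrated on nested pairs, so
  $\nu$ is smaller than $\nu'$ exactly when they are the two margins of a joining. Three facts give
  a maximal IRO above $\nu$.
  
  \<^item> Compactness. The joinings with first margin $\nu$ form a nonempty compact set. Summing, with
    factors $2^{-n}$ along an enumeration $q_n$ of the pairs of group elements, the probabilities
    that $q_n$ lies in the second order gives a continuous function on it, which therefore has a
    maximum, at some joining with second margin $\nu'$ (\<open>maximal_mass_joining\<close>).
  
  \<^item> Transitivity. If $\nu'$ is smaller than $\nu''$, then $\nu$ is smaller than $\nu''$
    (\<open>ext_le_trans\<close>), so the mass of $\nu''$ is at most the mass of $\nu'$.
  
  \<^item> Strictness. In a joining the second order contains the first, so every summand of its mass is at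
    least the corresponding one of the first. If the second mass is not larger, all summands agree,
    hence the two orders are almost surely equal and so are the margins (\<open>joining_equal_mass\<close>).
    Applied to a joining of $\nu'$ and $\nu''$ this gives $\nu'' = \nu'$.
  
  Compactness and transitivity both need measures to be built, and both rest on one construction.
  A random subset $S$ of a countable set is determined by its cylinder weights, the probabilities
  $p(N, E)$ of the events $S \cap N = E$ for finite $N$ and $E \subseteq N$; conversely every
  nonnegative, normalised and consistent family of weights comes from a random set
  (\<open>random_set_with_cylinder_weights\<close>). Being an invariant nested joining is a set of
  closed conditions, each on finitely many weights (\<open>joining_weights\<close>), so compactness becomes Tychonoff's
  theorem in a power of $[0, 1]$. For transitivity one takes the relatively independent joining: the
  outer orders are made conditionally independent given the middle one. Since only the weights are
  wanted, this needs a conditional probability for one event at a time, that is the Radon-Nikodym theorem,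
  and no disintegration into conditional measures.
\<close>

section \<open>Random sets with prescribed cylinder weights\<close>

text \<open>
  The weight of \<open>(N, E)\<close> stands for the probability that a random subset of \<open>I\<close> meets \<open>N\<close> exactly
  in \<open>E\<close>; consistency says that a new point \<open>x\<close> is either missed or hit.
\<close>

definition cylinder_weights :: "'i set \<Rightarrow> ('i set \<Rightarrow> 'i set \<Rightarrow> real) \<Rightarrow> bool" where
  "cylinder_weights I p \<longleftrightarrow> p {} {} = 1 \<and>
     (\<forall>N E. finite N \<and> N \<subseteq> I \<and> E \<subseteq> N \<longrightarrow> 0 \<le> p N E \<and>
        (\<forall>x\<in>I - N. p N E = p (insert x N) E + p (insert x N) (insert x E)))"

text \<open>
  A uniform point of $[0, 1)$ serves as the source of randomness. The patterns on the first \<open>n\<close> points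
  of an enumeration \<open>i\<close> cut $[0, 1)$ into intervals, the interval of \<open>E\<close> starting at \<open>left_end\<close> and
  having the weight of \<open>E\<close> as its length. Passing to \<open>n + 1\<close> cuts each interval in two: the left part
  keeps the pattern, the right part adds the new point. Enumerations may repeat, so that
  finite index sets are covered as well; a repeated point changes nothing.
\<close>

primrec left_end :: "('i set \<Rightarrow> 'i set \<Rightarrow> real) \<Rightarrow> (nat \<Rightarrow> 'i) \<Rightarrow> nat \<Rightarrow> 'i set \<Rightarrow> real" where
  "left_end p i 0 E = 0"
| "left_end p i (Suc n) E =
     (if i n \<in> i ` {..<n} \<or> i n \<notin> E then left_end p i n E
      else left_end p i n (E - {i n}) + p (i ` {..<Suc n}) (E - {i n}))"

primrec pattern_at :: "('i set \<Rightarrow> 'i set \<Rightarrow> real) \<Rightarrow> (nat \<Rightarrow> 'i) \<Rightarrow> nat \<Rightarrow> real \<Rightarrow> 'i set" where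
  "pattern_at p i 0 u = {}"
| "pattern_at p i (Suc n) u =
     (if i n \<in> i ` {..<n} \<or>
         u < left_end p i n (pattern_at p i n u) + p (i ` {..<Suc n}) (pattern_at p i n u)
      then pattern_at p i n u else insert (i n) (pattern_at p i n u))"

lemma pattern_at_subset: "pattern_at p i n u \<subseteq> i ` {..<n}"
proof (induction n)
  case (Suc n)
  then show ?case by (auto simp: lessThan_Suc)
qed simp

lemma cylinder_weights_nonneg:
  assumes "cylinder_weights I p" "finite N" "N \<subseteq> I" "E \<subseteq> N"
  shows "0 \<le> p N E"
  using assms unfolding cylinder_weights_def by blast

lemma cylinder_weights_split:
  assumes "cylinder_weights I p" "finite N" "N \<subseteq> I" "E \<subseteq> N" "x \<in> I - N"
  shows "p N E = p (insert x N) E + p (insert x N) (insert x E)"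
  using assms unfolding cylinder_weights_def by blast

lemma left_end_bounds:
  assumes p: "cylinder_weights (range i) p" and "E \<subseteq> i ` {..<n}"
  shows "0 \<le> left_end p i n E \<and> left_end p i n E + p (i ` {..<n}) E \<le> 1 \<and> 0 \<le> p (i ` {..<n}) E"
  using \<open>E \<subseteq> i ` {..<n}\<close>
proof (induction n arbitrary: E)
  case 0
  then show ?case using p by (simp add: cylinder_weights_def)
next
  case (Suc n)
  let ?N = "i ` {..<n}" and ?N' = "i ` {..<Suc n}"
  have N': "?N' = insert (i n) ?N"
    by (simp add: lessThan_Suc)
  show ?case
  proof (cases "i n \<in> ?N")
    case True
    then have "?N' = ?N" using N' by auto
    then show ?thesis using True Suc by simp
  next
    case new: False
    define F where "F = E - {i n}"
    have F: "F \<subseteq> ?N" "i n \<notin> F" using Suc.prems N' by (auto simp: F_def)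
    have split: "p ?N F = p ?N' F + p ?N' (insert (i n) F)"
      unfolding N' using F new by (intro cylinder_weights_split[OF p]) auto
    have nn: "0 \<le> p ?N' F" "0 \<le> p ?N' (insert (i n) F)"
      by (rule cylinder_weights_nonneg[OF p], use F N' in auto)+
    have "E = insert (i n) F \<or> E = F" by (auto simp: F_def)
    then show ?thesis using Suc.IH[OF F(1)] split nn new F(2) by auto
  qed
qed

lemma pattern_at_eq_iff:
  assumes p: "cylinder_weights (range i) p" and u: "0 \<le> u" "u < 1" and "E \<subseteq> i ` {..<n}"
  shows "pattern_at p i n u = E \<longleftrightarrow>
    u \<in> {left_end p i n E ..< left_end p i n E + p (i ` {..<n}) E}"
  using \<open>E \<subseteq> i ` {..<n}\<close>
proof (induction n arbitrary: E)
  case 0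
  then show ?case using u p by (auto simp: cylinder_weights_def)
next
  case (Suc n)
  let ?N = "i ` {..<n}" and ?N' = "i ` {..<Suc n}"
  have N': "?N' = insert (i n) ?N"
    by (simp add: lessThan_Suc)
  show ?case
  proof (cases "i n \<in> ?N")
    case True
    then have "?N' = ?N" using N' by auto
    then show ?thesis using True Suc by simp
  next
    case new: False
    have split: "p ?N F = p ?N' F + p ?N' (insert (i n) F)"
      and nonneg: "0 \<le> p ?N' F" "0 \<le> p ?N' (insert (i n) F)" if "F \<subseteq> ?N" for F
      unfolding N' using that new
      by (auto intro!: cylinder_weights_split[OF p] cylinder_weights_nonneg[OF p])
    have fresh: "i n \<notin> pattern_at p i n u"
      using pattern_at_subset[of p i n u] new by blast
    show ?thesis
    proof (cases "i n \<in> E")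
      case False
      then have "E \<subseteq> ?N" using Suc.prems N' by auto
      then show ?thesis
        using Suc.IH[OF \<open>E \<subseteq> ?N\<close>] split[OF \<open>E \<subseteq> ?N\<close>] nonneg[OF \<open>E \<subseteq> ?N\<close>] False new fresh
        by (auto simp del: lessThan_Suc image_insert)
    next
      case True
      define F where "F = E - {i n}"
      have F: "F \<subseteq> ?N" "E = insert (i n) F" "i n \<notin> F"
        using Suc.prems N' True by (auto simp: F_def)
      then show ?thesis
        using Suc.IH[OF F(1)] split[OF F(1)] nonneg[OF F(1)] new fresh
        by (auto simp del: lessThan_Suc image_insert simp: insert_ident)
    qed
  qed
qed

text \<open>
  Later stages decide only points that are new, so the pattern of stage \<open>n\<close> is the trace of the limit
  set.
\<close>

lemma pattern_at_limit: 
  "(\<Union>m. pattern_at p i m u) \<inter> i ` {..<n} = pattern_at p i n u"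
proof -
  have mono: "pattern_at p i m u \<subseteq> pattern_at p i (m + k) u" for m k
    by (induction k) auto
  \<comment> \<open>A repeated point of the enumeration is skipped, so points of the first \<open>n\<close> are never added later.\<close>
  have stable: "pattern_at p i (n + k) u \<inter> i ` {..<n} \<subseteq> pattern_at p i n u" for k
  proof (induction k)
    case (Suc k)
    show ?case
    proof (cases "i (n + k) \<in> i ` {..<n + k}")
      case True
      then show ?thesis using Suc by simp
    next
      case False
      moreover have "i ` {..<n} \<subseteq> i ` {..<n + k}" by auto
      ultimately have "i (n + k) \<notin> i ` {..<n}" by blast
      then show ?thesis using Suc by simp
    qed
  qed auto
  have "pattern_at p i m u \<inter> i ` {..<n} \<subseteq> pattern_at p i n u" for m
  proof (cases "m \<le> n")
    case True
    then show ?thesis using mono[of m "n - m"] by auto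
  next
    case False
    then show ?thesis using stable[of "m - n"] by auto
  qed
  then show ?thesis
    using pattern_at_subset[of p i n u] by blast
qed

lemma pattern_split:
  assumes "x \<notin> N" "E \<subseteq> N"
  shows "S \<inter> N = E \<longleftrightarrow> S \<inter> insert x N = E \<or> S \<inter> insert x N = insert x E"
proof (cases "x \<in> S")
  case True
  have "insert x (S \<inter> N) = insert x E \<longleftrightarrow> S \<inter> N = E"
    using assms by (intro insert_ident) auto
  moreover have "insert x (S \<inter> N) \<noteq> E"
    using assms by blast
  ultimately show ?thesis
    using True by simp
next
  case False
  then show ?thesis
    by auto
qed

text \<open>
  Kolmogorov's extension theorem for two-valued processes, with Lebesgue measure on $[0, 1)$ as the sample space.
  The interval construction handles the initial segments of an enumeration, and consistency
  carries the result down to their subsets.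
\<close>

lemma random_set_with_cylinder_weights:
  fixes I :: "'i set" and p :: "'i set \<Rightarrow> 'i set \<Rightarrow> real"
  assumes I: "countable I" "I \<noteq> {}" and p: "cylinder_weights I p"
  obtains M :: "real measure" and S :: "real \<Rightarrow> 'i set" where
    "prob_space M" "\<And>u. S u \<subseteq> I"
    "\<And>N E. finite N \<Longrightarrow> N \<subseteq> I \<Longrightarrow> E \<subseteq> N \<Longrightarrow> {u \<in> space M. S u \<inter> N = E} \<in> sets M"
    "\<And>N E. finite N \<Longrightarrow> N \<subseteq> I \<Longrightarrow> E \<subseteq> N \<Longrightarrow> measure M {u \<in> space M. S u \<inter> N = E} = p N E"
proof -
  define i where "i = from_nat_into I"
  have i: "range i = I"
    using I by (simp add: i_def)
  define M where "M = restrict_space lborel {0..<1::real}"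
  define S where "S = (\<lambda>u. \<Union>n. pattern_at p i n u)"
  have space: "space M = {0..<1}"
    by (simp add: M_def space_restrict_space)
  have p': "cylinder_weights (range i) p"
    using p i by simp
  interpret prob_space M
    by (rule prob_spaceI) (simp add: M_def space_restrict_space emeasure_restrict_space)
  have S: "S u \<subseteq> I" for u
    using pattern_at_subset[of p i _ u] i by (fastforce simp: S_def)
  have full: "{u \<in> space M. S u \<inter> i ` {..<n} = E} \<in> sets M \<and>
      measure M {u \<in> space M. S u \<inter> i ` {..<n} = E} = p (i ` {..<n}) E"
    if E: "E \<subseteq> i ` {..<n}" for n E
  proof -
    let ?J = "{left_end p i n E ..< left_end p i n E + p (i ` {..<n}) E}"
    have "?J \<subseteq> {0..<1}" and nonneg: "0 \<le> p (i ` {..<n}) E"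
      using left_end_bounds[OF p' E] by auto
    have eq: "{u \<in> space M. S u \<inter> i ` {..<n} = E} = ?J"
    proof (rule Set.set_eqI)
      fix u
      show "u \<in> {u \<in> space M. S u \<inter> i ` {..<n} = E} \<longleftrightarrow> u \<in> ?J"
      proof (cases "u \<in> {0..<1}")
        case True
        then show ?thesis
          using pattern_at_eq_iff[OF p' _ _ E, of u]
          by (simp add: space S_def pattern_at_limit)
      next
        case False
        then show ?thesis
          using \<open>?J \<subseteq> {0..<1}\<close> unfolding space by blast
      qed
    qed
    have "measure M ?J = p (i ` {..<n}) E"
      using \<open>?J \<subseteq> {0..<1}\<close> nonneg unfolding M_def by (subst measure_restrict_space) auto
    then show ?thesis
      using eq \<open>?J \<subseteq> {0..<1}\<close> by (auto simp: M_def sets_restrict_space_iff)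
  qed
  have all: "{u \<in> space M. S u \<inter> N = E} \<in> sets M \<and>
      measure M {u \<in> space M. S u \<inter> N = E} = p N E"
    if N: "finite N" "N \<subseteq> I" and E: "E \<subseteq> N" for N E
  proof -
    obtain n where n: "N \<subseteq> i ` {..<n}"
    proof -
      have "\<exists>K. finite K \<and> N = i ` K"
        using N i by (metis finite_subset_image subset_UNIV)
      then obtain K where "finite K" "N = i ` K" by blast
      moreover obtain n where "K \<subseteq> {..<n}"
        using \<open>finite K\<close> finite_nat_iff_bounded by blast
      ultimately show ?thesis using that by blast
    qed
    show ?thesis
      using N E n
    proof (induction "card (i ` {..<n} - N)" arbitrary: N E)
      case 0
      then have "i ` {..<n} - N = {}" by (metis card_0_eq finite_Diff finite_imageI finite_lessThan)
      then have "N = i ` {..<n}" using 0 by auto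
      then show ?case using full 0 by auto
    next
      case (Suc k)
      then obtain x where x: "x \<in> i ` {..<n} - N"
        by (metis card.empty equals0I nat.distinct(1))
      have k: "k = card (i ` {..<n} - insert x N)"
      proof -
        have "i ` {..<n} - insert x N = (i ` {..<n} - N) - {x}" by auto
        then show ?thesis using Suc.hyps(2) x by (simp add: card_Diff_singleton_if)
      qed
      have xI: "x \<in> I" using x i by auto
      let ?A = "{u \<in> space M. S u \<inter> insert x N = E}"
      let ?B = "{u \<in> space M. S u \<inter> insert x N = insert x E}"
      have A: "?A \<in> sets M \<and> measure M ?A = p (insert x N) E"
        using Suc.prems x xI by (intro Suc.hyps(1)[OF k]) auto
      have B: "?B \<in> sets M \<and> measure M ?B = p (insert x N) (insert x E)"
        using Suc.prems x xI by (intro Suc.hyps(1)[OF k]) auto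
      have "S u \<inter> N = E \<longleftrightarrow> S u \<inter> insert x N = E \<or> S u \<inter> insert x N = insert x E" for u
        using x Suc.prems by (intro pattern_split) auto
      then have eq: "{u \<in> space M. S u \<inter> N = E} = ?A \<union> ?B"
        by auto
      have "?A \<inter> ?B = {}"
        using x Suc.prems by auto
      then have "measure M (?A \<union> ?B) = measure M ?A + measure M ?B"
        using A B by (intro finite_measure_Union) auto
      moreover have "p N E = p (insert x N) E + p (insert x N) (insert x E)"
        using Suc.prems x xI by (intro cylinder_weights_split[OF p]) auto
      ultimately show ?case
        using A B unfolding eq by auto
    qed
  qed
  show ?thesis
    by (rule that[of M S]) (use all S prob_space_axioms in auto)
qed

section \<open>Spaces coded by subsets of a countable set\<close>

text \<open>
  A space coded by the subsets of a countable set: \<open>e w\<close> is the set of coordinates at which \<open>w\<close> takes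
  the value true. The topology is that of pointwise convergence of the coordinates, and the
  last assumption says that the codes form a closed subset of the Cantor space of all subsets.
\<close>

locale coordinates =
  fixes X :: "'w topology" and I :: "'i set" and e :: "'w \<Rightarrow> 'i set"
  assumes countable_index: "countable I" and index_nonempty: "I \<noteq> {}"
    and coord_subset: "w \<in> topspace X \<Longrightarrow> e w \<subseteq> I"
    and openin_iff: "openin X U \<longleftrightarrow> U \<subseteq> topspace X \<and>
      (\<forall>w\<in>U. \<exists>N. finite N \<and> N \<subseteq> I \<and> (\<forall>v\<in>topspace X. e v \<inter> N = e w \<inter> N \<longrightarrow> v \<in> U))"
    and complete: "S \<subseteq> I \<Longrightarrow>
      (\<And>N. finite N \<Longrightarrow> N \<subseteq> I \<Longrightarrow> \<exists>w\<in>topspace X. e w \<inter> N = S \<inter> N) \<Longrightarrow>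
      \<exists>w\<in>topspace X. e w = S"
begin

definition cyl :: "'i set \<Rightarrow> 'i set \<Rightarrow> 'w set" where
  "cyl N E = {w \<in> topspace X. e w \<inter> N = E}"

definition patterns :: "('i set \<times> 'i set) set" where
  "patterns = {(N, E). finite N \<and> N \<subseteq> I \<and> E \<subseteq> N}"

lemma countable_patterns: "countable patterns"
proof (rule countable_subset)
  let ?F = "{N. finite N \<and> N \<subseteq> I}"
  show "patterns \<subseteq> ?F \<times> ?F"
    by (auto simp: patterns_def intro: finite_subset)
  show "countable (?F \<times> ?F)"
    by (intro countable_SIGMA countable_Collect_finite_subset countable_index)
qed

lemma cyl_Int:
  assumes "E \<subseteq> N" "E' \<subseteq> N'" "cyl N E \<inter> cyl N' E' \<noteq> {}"
  shows "cyl N E \<inter> cyl N' E' = cyl (N \<union> N') (E \<union> E')"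
  using assms by (auto simp: cyl_def)

lemma openin_cyl:
  assumes "finite N" "N \<subseteq> I"
  shows "openin X (cyl N E)"
  unfolding openin_iff using assms by (intro conjI ballI exI[of _ N]) (auto simp: cyl_def)

lemma sets_cyl:
  assumes "sets \<mu> = sets (borel_space X)" "finite N" "N \<subseteq> I"
  shows "cyl N E \<in> sets \<mu>"
  using openin_cyl[OF assms(2,3)] assms(1) by (auto simp: sets_borel_space)

text \<open>
  Every open set is a union of cylinders, and there are only countably many of them.
\<close>

lemma sets_borel_eq: "sets (borel_space X) = sigma_sets (topspace X) (case_prod cyl ` patterns)"
proof -
  have "sigma_sets (topspace X) {U. openin X U} = sigma_sets (topspace X) (case_prod cyl ` patterns)"
  proof (rule sigma_sets_eqI)
    fix U assume "U \<in> {U. openin X U}"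
    then have U: "U \<subseteq> topspace X"
      "\<forall>w\<in>U. \<exists>N. finite N \<and> N \<subseteq> I \<and> (\<forall>v\<in>topspace X. e v \<inter> N = e w \<inter> N \<longrightarrow> v \<in> U)"
      by (auto simp: openin_iff)
    have "U = (\<Union>(N, E) \<in> {q \<in> patterns. case_prod cyl q \<subseteq> U}. cyl N E)"
    proof
      show "U \<subseteq> (\<Union>(N, E) \<in> {q \<in> patterns. case_prod cyl q \<subseteq> U}. cyl N E)"
      proof
        fix w assume w: "w \<in> U"
        obtain N where N: "finite N" "N \<subseteq> I" "\<forall>v\<in>topspace X. e v \<inter> N = e w \<inter> N \<longrightarrow> v \<in> U"
          using bspec[OF U(2) w] by auto
        then have "cyl N (e w \<inter> N) \<subseteq> U" "w \<in> cyl N (e w \<inter> N)" "(N, e w \<inter> N) \<in> patterns"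
          using w U(1) by (auto simp: cyl_def patterns_def)
        then show "w \<in> (\<Union>(N, E) \<in> {q \<in> patterns. case_prod cyl q \<subseteq> U}. cyl N E)"
          by blast
      qed
    qed auto
    moreover have "(\<Union>(N, E) \<in> {q \<in> patterns. case_prod cyl q \<subseteq> U}. cyl N E)
        \<in> sigma_sets (topspace X) (case_prod cyl ` patterns)"
      using countable_patterns
      by (intro sigma_sets_UNION countable_image)
         (auto intro: sigma_sets.Basic countable_subset[of _ patterns])
    ultimately show "U \<in> sigma_sets (topspace X) (case_prod cyl ` patterns)"
      by simp
  next
    fix U assume "U \<in> case_prod cyl ` patterns"
    then show "U \<in> sigma_sets (topspace X) {U. openin X U}"
      using openin_cyl by (auto simp: patterns_def)
  qed
  then show ?thesis
    by (simp add: sets_borel_space)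
qed

lemma measure_eq_of_cyl:
  assumes "borel_prob X \<mu>" "borel_prob X \<nu>"
    and eq: "\<And>N E. finite N \<Longrightarrow> N \<subseteq> I \<Longrightarrow> E \<subseteq> N \<Longrightarrow> measure \<mu> (cyl N E) = measure \<nu> (cyl N E)"
  shows "\<mu> = \<nu>"
proof -
  interpret \<mu>: prob_space \<mu> using assms(1) by (simp add: borel_prob_def)
  interpret \<nu>: prob_space \<nu> using assms(2) by (simp add: borel_prob_def)
  have top: "cyl {} {} = topspace X"
    by (simp add: cyl_def)
  show ?thesis
  proof (rule measure_eqI_generator_eq)
    show "Int_stable (insert {} (case_prod cyl ` patterns))"
    proof (rule Int_stableI)
      fix A B
      assume A: "A \<in> insert {} (case_prod cyl ` patterns)" and B: "B \<in> insert {} (case_prod cyl ` patterns)"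
      show "A \<inter> B \<in> insert {} (case_prod cyl ` patterns)"
      proof (cases "A \<inter> B = {}")
        case False
        then obtain N E N' E' where *: "A = cyl N E" "(N, E) \<in> patterns" "B = cyl N' E'" "(N', E') \<in> patterns"
          using A B by auto
        then have "A \<inter> B = cyl (N \<union> N') (E \<union> E')"
          using False cyl_Int by (auto simp: patterns_def)
        moreover have "(N \<union> N', E \<union> E') \<in> patterns"
          using * by (auto simp: patterns_def)
        ultimately show ?thesis by (metis case_prod_conv image_eqI insertI2)
      qed simp
    qed
    show "insert {} (case_prod cyl ` patterns) \<subseteq> Pow (topspace X)"
      by (auto simp: cyl_def)
    show "emeasure \<mu> A = emeasure \<nu> A" if "A \<in> insert {} (case_prod cyl ` patterns)" for A
      using that eq by (auto simp: patterns_def \<mu>.emeasure_eq_measure \<nu>.emeasure_eq_measure)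
    have "sigma_sets (topspace X) (insert {} (case_prod cyl ` patterns)) =
        sigma_sets (topspace X) (case_prod cyl ` patterns)"
      by (rule sigma_sets_eqI) (auto intro: sigma_sets.Empty)
    then show "sets \<mu> = sigma_sets (topspace X) (insert {} (case_prod cyl ` patterns))"
      "sets \<nu> = sigma_sets (topspace X) (insert {} (case_prod cyl ` patterns))"
      using assms(1,2) by (auto simp: borel_prob_def sets_borel_eq)
    show "range (\<lambda>n::nat. topspace X) \<subseteq> insert {} (case_prod cyl ` patterns)"
      using top by (auto simp: patterns_def image_iff intro!: exI[of _ "{}"])
  qed auto
qed

lemma measurable_of_cyl:
  assumes "\<And>u. u \<in> space M \<Longrightarrow> f u \<in> topspace X"
    and "\<And>N E. finite N \<Longrightarrow> N \<subseteq> I \<Longrightarrow> E \<subseteq> N \<Longrightarrow> {u \<in> space M. e (f u) \<inter> N = E} \<in> sets M"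
  shows "f \<in> measurable M (borel_space X)"
proof (rule measurable_sigma_sets[OF sets_borel_eq])
  show "case_prod cyl ` patterns \<subseteq> Pow (topspace X)"
    by (auto simp: cyl_def)
  show "f \<in> space M \<rightarrow> topspace X"
    using assms(1) by auto
  fix A assume "A \<in> case_prod cyl ` patterns"
  then obtain N E where NE: "A = cyl N E" "finite N" "N \<subseteq> I" "E \<subseteq> N"
    by (auto simp: patterns_def)
  have "f -` A \<inter> space M = {u \<in> space M. e (f u) \<inter> N = E}"
    using assms(1) NE(1) by (auto simp: cyl_def)
  then show "f -` A \<inter> space M \<in> sets M"
    using assms(2)[OF NE(2-4)] by simp
qed

lemma cyl_split:
  assumes "x \<notin> N" "E \<subseteq> N"
  shows "cyl N E = cyl (insert x N) E \<union> cyl (insert x N) (insert x E)"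
    and "cyl (insert x N) E \<inter> cyl (insert x N) (insert x E) = {}"
proof -
  have "S \<inter> N = E \<longleftrightarrow> S \<inter> insert x N = E \<or> S \<inter> insert x N = insert x E" for S
    by (rule pattern_split[OF assms])
  then show "cyl N E = cyl (insert x N) E \<union> cyl (insert x N) (insert x E)"
    by (auto simp: cyl_def)
  show "cyl (insert x N) E \<inter> cyl (insert x N) (insert x E) = {}"
    using assms by (auto simp: cyl_def)
qed

lemma cylinder_weights_measure:
  assumes "borel_prob X \<mu>"
  shows "cylinder_weights I (\<lambda>N E. measure \<mu> (cyl N E))"
proof -
  interpret prob_space \<mu> using assms by (simp add: borel_prob_def)
  have sets: "sets \<mu> = sets (borel_space X)" using assms by (simp add: borel_prob_def)
  then have "space \<mu> = topspace X" by (metis sets_eq_imp_space_eq space_borel_space)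
  then have "measure \<mu> (cyl {} {}) = 1"
    using prob_space by (simp add: cyl_def)
  moreover have "measure \<mu> (cyl N E) =
      measure \<mu> (cyl (insert x N) E) + measure \<mu> (cyl (insert x N) (insert x E))"
    if "finite N" "N \<subseteq> I" "E \<subseteq> N" "x \<in> I - N" for N E x
  proof -
    have "cyl (insert x N) E \<in> sets \<mu>" "cyl (insert x N) (insert x E) \<in> sets \<mu>"
      using that sets_cyl[OF sets] by auto
    then show ?thesis
      using cyl_split[of x N E] that by (simp add: finite_measure_Union)
  qed
  ultimately show ?thesis
    by (auto simp: cylinder_weights_def)
qed

text \<open>
  The random set of the extension theorem need not code a point, but closedness of the set of codes
  means that a set which is not a code shows an impossible pattern on some finite set. There are
  countably many of these and each has weight zero, so almost every value is a code.
\<close>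

lemma measure_with_cylinder_weights:
  assumes p: "cylinder_weights I p"
    and impossible: "\<And>N E. finite N \<Longrightarrow> N \<subseteq> I \<Longrightarrow> E \<subseteq> N \<Longrightarrow> cyl N E = {} \<Longrightarrow> p N E = 0"
  obtains \<mu> where "borel_prob X \<mu>"
    "\<And>N E. finite N \<Longrightarrow> N \<subseteq> I \<Longrightarrow> E \<subseteq> N \<Longrightarrow> measure \<mu> (cyl N E) = p N E"
proof -
  obtain M :: "real measure" and S where M: "prob_space M" and S: "\<And>u. S u \<subseteq> I"
    and meas: "\<And>N E. finite N \<Longrightarrow> N \<subseteq> I \<Longrightarrow> E \<subseteq> N \<Longrightarrow> {u \<in> space M. S u \<inter> N = E} \<in> sets M"
    and law: "\<And>N E. finite N \<Longrightarrow> N \<subseteq> I \<Longrightarrow> E \<subseteq> N \<Longrightarrow> measure M {u \<in> space M. S u \<inter> N = E} = p N E"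
    using random_set_with_cylinder_weights[OF countable_index index_nonempty p] by blast
  interpret prob_space M by (rule M)
  have "AE u in M. \<forall>q\<in>{q\<in>patterns. case_prod cyl q = {}}. S u \<inter> fst q \<noteq> snd q"
  proof (rule AE_ball_countable[THEN iffD2], use countable_patterns in auto, goal_cases)
    case (1 N E)
    then have "finite N" "N \<subseteq> I" "E \<subseteq> N" by (auto simp: patterns_def)
    then have "{u \<in> space M. S u \<inter> N = E} \<in> null_sets M"
      using impossible[of N E] 1 law[of N E] meas[of N E] by (auto simp: null_sets_def emeasure_eq_measure)
    then show ?case by (rule AE_I') auto
  qed
  then have good: "AE u in M. \<exists>w\<in>topspace X. e w = S u"
  proof eventually_elim
    case (elim u)
    show ?case
    proof (rule complete[OF S])
      fix N assume N: "finite N" "N \<subseteq> I"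
      then have "cyl N (S u \<inter> N) \<noteq> {}"
        using bspec[OF elim, of "(N, S u \<inter> N)"] by (auto simp: patterns_def)
      then show "\<exists>w\<in>topspace X. e w \<inter> N = S u \<inter> N" by (auto simp: cyl_def)
    qed
  qed
  \<comment> \<open>The value on the null set \<open>Z\<close> is arbitrary, but it must be a point of the space.\<close>
  obtain Z where Z: "{u \<in> space M. \<not> (\<exists>w\<in>topspace X. e w = S u)} \<subseteq> Z" "emeasure M Z = 0" "Z \<in> sets M"
    using AE_E[OF good] by blast
  obtain w0 where w0: "w0 \<in> topspace X"
  proof -
    have "Z \<noteq> space M" using Z(2) emeasure_space_1 by auto
    then obtain u where "u \<in> space M" "u \<notin> Z" using sets.sets_into_space[OF Z(3)] by blast
    then show ?thesis using Z(1) that by blast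
  qed
  define f where "f u = (if u \<in> Z then w0 else SOME w. w \<in> topspace X \<and> e w = S u)" for u
  have f: "f u \<in> topspace X \<and> e (f u) = S u" if "u \<in> space M - Z" for u
  proof -
    have "\<exists>w. w \<in> topspace X \<and> e w = S u" using that Z(1) by blast
    then show ?thesis using someI_ex that unfolding f_def by simp
  qed
  have f_top: "f u \<in> topspace X" if "u \<in> space M" for u
    using f[of u] that w0 by (cases "u \<in> Z") (auto simp: f_def)
  have "f \<in> measurable M (borel_space X)"
  proof (rule measurable_of_cyl)
    fix N E assume NE: "finite N" "N \<subseteq> I" "E \<subseteq> N"
    have "{u \<in> space M. e (f u) \<inter> N = E} =
      ({u \<in> space M. S u \<inter> N = E} - Z) \<union> (if e w0 \<inter> N = E then Z else {})"
      using f sets.sets_into_space[OF Z(3)] by (auto simp: f_def)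
    then show "{u \<in> space M. e (f u) \<inter> N = E} \<in> sets M"
      using meas[OF NE] Z(3) by simp
  qed (rule f_top)
  define \<mu> where "\<mu> = distr M (borel_space X) f"
  have "borel_prob X \<mu>"
    using \<open>f \<in> _\<close> by (simp add: \<mu>_def borel_prob_def prob_space_distr)
  moreover have "measure \<mu> (cyl N E) = p N E" if NE: "finite N" "N \<subseteq> I" "E \<subseteq> N" for N E
  proof -
    have cyl: "cyl N E \<in> sets (borel_space X)"
      using sets_cyl[OF refl NE(1,2)] .
    have "measure \<mu> (cyl N E) = measure M (f -` cyl N E \<inter> space M)"
      unfolding \<mu>_def by (rule measure_distr[OF \<open>f \<in> _\<close> cyl])
    also have "\<dots> = measure M {u \<in> space M. S u \<inter> N = E}"
    proof (rule finite_measure_eq_AE)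
      have "AE u in M. u \<notin> Z" using Z by (intro AE_not_in) auto
      then show "AE u in M. (u \<in> f -` cyl N E \<inter> space M) = (u \<in> {u \<in> space M. S u \<inter> N = E})"
      proof (rule AE_mp, intro AE_I2 impI)
        fix u assume "u \<in> space M" "u \<notin> Z"
        then show "(u \<in> f -` cyl N E \<inter> space M) = (u \<in> {u \<in> space M. S u \<inter> N = E})"
          using f[of u] by (auto simp: cyl_def)
      qed
      show "f -` cyl N E \<inter> space M \<in> sets M"
        using measurable_sets[OF \<open>f \<in> _\<close> cyl] .
    qed (rule meas[OF NE])
    finally show ?thesis using law[OF NE] by simp
  qed
  ultimately show ?thesis by (rule that)
qed

end

section \<open>Products and spaces of partial orders\<close>

context coordinates
begin

lemma openin_neighbourhood:
  assumes "openin X U" "w \<in> U"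
  obtains N where "finite N" "N \<subseteq> I" "\<forall>v\<in>topspace X. e v \<inter> N = e w \<inter> N \<longrightarrow> v \<in> U"
proof -
  have "\<forall>w\<in>U. \<exists>N. finite N \<and> N \<subseteq> I \<and> (\<forall>v\<in>topspace X. e v \<inter> N = e w \<inter> N \<longrightarrow> v \<in> U)"
    using assms(1) unfolding openin_iff by (rule conjunct2)
  from bspec[OF this assms(2)] show ?thesis
    using that by auto
qed

lemma cyl_vimage:
  assumes a: "a \<in> topspace X \<rightarrow> topspace X"
    and t: "inj_on t I" "t \<in> I \<rightarrow> I"
    and coord: "\<And>w i. w \<in> topspace X \<Longrightarrow> i \<in> I \<Longrightarrow> i \<in> e (a w) \<longleftrightarrow> t i \<in> e w"
    and NE: "N \<subseteq> I" "E \<subseteq> N"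
  shows "a -` cyl N E \<inter> topspace X = cyl (t ` N) (t ` E)"
proof -
  have "e (a w) \<inter> N = E \<longleftrightarrow> e w \<inter> t ` N = t ` E" if w: "w \<in> topspace X" for w
  proof -
    have "e (a w) \<inter> N = E \<longleftrightarrow> (\<forall>i\<in>N. t i \<in> e w \<longleftrightarrow> i \<in> E)"
      using coord[OF w] NE by blast
    also have "\<dots> \<longleftrightarrow> (\<forall>i\<in>N. t i \<in> e w \<longleftrightarrow> t i \<in> t ` E)"
      using inj_on_image_mem_iff[OF t(1)] NE by (metis subset_eq)
    also have "\<dots> \<longleftrightarrow> e w \<inter> t ` N = t ` E"
      using NE(2) by blast
    finally show ?thesis .
  qed
  then have "w \<in> a -` cyl N E \<inter> topspace X \<longleftrightarrow> w \<in> cyl (t ` N) (t ` E)" for w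
    using funcset_mem[OF a, of w] by (cases "w \<in> topspace X") (simp_all add: cyl_def)
  then show ?thesis
    by (rule Set.set_eqI)
qed

text \<open>
  For a map that only relabels the coordinates, invariance of a measure is a family of equations between single
  cylinder weights.
\<close>

lemma invariant_iff_cyl:
  assumes \<mu>: "borel_prob X \<mu>" and a: "continuous_map X X a"
    and t: "inj_on t I" "t \<in> I \<rightarrow> I"
    and coord: "\<And>w i. w \<in> topspace X \<Longrightarrow> i \<in> I \<Longrightarrow> i \<in> e (a w) \<longleftrightarrow> t i \<in> e w"
  shows "distr \<mu> (borel_space X) a = \<mu> \<longleftrightarrow>
    (\<forall>N E. finite N \<and> N \<subseteq> I \<and> E \<subseteq> N \<longrightarrow> measure \<mu> (cyl (t ` N) (t ` E)) = measure \<mu> (cyl N E))"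
    (is "?L \<longleftrightarrow> ?R")
proof -
  interpret prob_space \<mu> using \<mu> by (simp add: borel_prob_def)
  have sets: "sets \<mu> = sets (borel_space X)" using \<mu> by (simp add: borel_prob_def)
  then have space: "space \<mu> = topspace X" by (metis sets_eq_imp_space_eq space_borel_space)
  have a_meas: "a \<in> measurable \<mu> (borel_space X)"
    using continuous_map_measurable[OF a] sets by (simp cong: measurable_cong_sets)
  have *: "measure (distr \<mu> (borel_space X) a) (cyl N E) = measure \<mu> (cyl (t ` N) (t ` E))"
    if "finite N" "N \<subseteq> I" "E \<subseteq> N" for N E
    using cyl_vimage[OF continuous_map_funspace[OF a] t coord that(2,3)] space
    by (subst measure_distr[OF a_meas sets_cyl[OF refl that(1,2)]]) auto
  have prob: "borel_prob X (distr \<mu> (borel_space X) a)"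
    using a_meas by (simp add: borel_prob_def prob_space_distr)
  show ?thesis
  proof
    assume ?L
    then show ?R using * by metis
  next
    assume ?R
    then show ?L
      using * by (intro measure_eq_of_cyl[OF prob \<mu>]) auto
  qed
qed

end

lemma sum_set_eq_iff: "S = T \<longleftrightarrow> Inl -` S = Inl -` T \<and> Inr -` S = Inr -` T"
proof
  assume eq: "Inl -` S = Inl -` T \<and> Inr -` S = Inr -` T"
  have "x \<in> S \<longleftrightarrow> x \<in> T" for x
    using eq by (cases x) auto
  then show "S = T" by auto
qed auto

lemma vimage_Plus [simp]: "Inl -` (A <+> B) = A" "Inr -` (A <+> B) = B"
  by auto

lemma Plus_Int_eq_iff:
  "(A <+> B) \<inter> N = E \<longleftrightarrow> A \<inter> Inl -` N = Inl -` E \<and> B \<inter> Inr -` N = Inr -` E"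
  by (subst sum_set_eq_iff) (simp add: vimage_Int)

lemma coordinates_prod:
  assumes "coordinates X I e" "coordinates Y J f"
  shows "coordinates (prod_topology X Y) (I <+> J) (\<lambda>w. e (fst w) <+> f (snd w))"
proof -
  interpret X: coordinates X I e by (rule assms(1))
  interpret Y: coordinates Y J f by (rule assms(2))
  show ?thesis
  proof
    show "countable (I <+> J)"
      using X.countable_index Y.countable_index by (rule countable_Plus)
    show "I <+> J \<noteq> {}"
      using X.index_nonempty by auto
    show "e (fst w) <+> f (snd w) \<subseteq> I <+> J" if "w \<in> topspace (prod_topology X Y)" for w
    proof -
      have "e (fst w) \<subseteq> I" "f (snd w) \<subseteq> J"
        using that X.coord_subset[of "fst w"] Y.coord_subset[of "snd w"] by (auto simp: mem_Times_iff)
      then show ?thesis by blast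
    qed
    show "openin (prod_topology X Y) U \<longleftrightarrow> U \<subseteq> topspace (prod_topology X Y) \<and>
      (\<forall>w\<in>U. \<exists>N. finite N \<and> N \<subseteq> I <+> J \<and> (\<forall>v\<in>topspace (prod_topology X Y).
        (e (fst v) <+> f (snd v)) \<inter> N = (e (fst w) <+> f (snd w)) \<inter> N \<longrightarrow> v \<in> U))" (is "?O \<longleftrightarrow> ?C") for U
    proof
      assume U: ?O
      show ?C
      proof (intro conjI ballI)
        show "U \<subseteq> topspace (prod_topology X Y)" using U by (rule openin_subset)
        fix w assume "w \<in> U"
        then obtain A B where AB: "openin X A" "openin Y B" "fst w \<in> A" "snd w \<in> B" "A \<times> B \<subseteq> U"
          using U[unfolded openin_prod_topology_alt, rule_format, of "fst w" "snd w"] by auto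
        obtain N where N: "finite N" "N \<subseteq> I" "\<forall>v\<in>topspace X. e v \<inter> N = e (fst w) \<inter> N \<longrightarrow> v \<in> A"
          by (rule X.openin_neighbourhood[OF AB(1,3)])
        obtain K where K: "finite K" "K \<subseteq> J" "\<forall>v\<in>topspace Y. f v \<inter> K = f (snd w) \<inter> K \<longrightarrow> v \<in> B"
          by (rule Y.openin_neighbourhood[OF AB(2,4)])
        have "v \<in> U" if v: "v \<in> topspace (prod_topology X Y)"
          "(e (fst v) <+> f (snd v)) \<inter> (N <+> K) = (e (fst w) <+> f (snd w)) \<inter> (N <+> K)" for v
        proof -
          have "e (fst v) \<inter> N = e (fst w) \<inter> N \<and> f (snd v) \<inter> K = f (snd w) \<inter> K"
            using v(2) by (simp add: Plus_Int_eq_iff vimage_Int)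
          then have "fst v \<in> A" "snd v \<in> B"
            using v(1) N(3) K(3) by (auto simp: mem_Times_iff)
          then show ?thesis using AB(5) by (auto simp: mem_Times_iff)
        qed
        then show "\<exists>N. finite N \<and> N \<subseteq> I <+> J \<and> (\<forall>v\<in>topspace (prod_topology X Y).
            (e (fst v) <+> f (snd v)) \<inter> N = (e (fst w) <+> f (snd w)) \<inter> N \<longrightarrow> v \<in> U)"
          using N K by (intro exI[of _ "N <+> K"]) auto
      qed
    next
      assume U: ?C
      show ?O
        unfolding openin_prod_topology_alt
      proof (intro allI impI)
        fix x y assume xy: "(x, y) \<in> U"
        have "\<exists>N. finite N \<and> N \<subseteq> I <+> J \<and> (\<forall>v\<in>topspace (prod_topology X Y).
            (e (fst v) <+> f (snd v)) \<inter> N = (e (fst (x, y)) <+> f (snd (x, y))) \<inter> N \<longrightarrow> v \<in> U)"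
          using bspec[OF conjunct2[OF U] xy] .
        then obtain N where N: "finite N" "N \<subseteq> I <+> J"
          and NU: "\<forall>v\<in>topspace (prod_topology X Y).
            (e (fst v) <+> f (snd v)) \<inter> N = (e x <+> f y) \<inter> N \<longrightarrow> v \<in> U"
          by auto
        have top: "x \<in> topspace X" "y \<in> topspace Y"
          using U xy by auto
        let ?A = "X.cyl (Inl -` N) (e x \<inter> Inl -` N)" and ?B = "Y.cyl (Inr -` N) (f y \<inter> Inr -` N)"
        have "openin X ?A" "openin Y ?B"
          using N by (auto intro!: X.openin_cyl Y.openin_cyl finite_vimageI)
        moreover have "x \<in> ?A" "y \<in> ?B"
          using top by (auto simp: X.cyl_def Y.cyl_def)
        moreover have "?A \<times> ?B \<subseteq> U"
          using NU by (auto simp: X.cyl_def Y.cyl_def Plus_Int_eq_iff vimage_Int)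
        ultimately show "\<exists>A B. openin X A \<and> openin Y B \<and> x \<in> A \<and> y \<in> B \<and> A \<times> B \<subseteq> U"
          by blast
      qed
    qed
    fix S assume S: "S \<subseteq> I <+> J"
      and loc: "\<And>N. finite N \<Longrightarrow> N \<subseteq> I <+> J \<Longrightarrow>
        \<exists>w\<in>topspace (prod_topology X Y). (e (fst w) <+> f (snd w)) \<inter> N = S \<inter> N"
    have "\<exists>x\<in>topspace X. e x = Inl -` S"
    proof (rule X.complete)
      fix N assume N: "finite N" "N \<subseteq> I"
      have sub: "N <+> {} \<subseteq> I <+> J"
        using N by blast
      obtain w where "w \<in> topspace (prod_topology X Y)"
        "(e (fst w) <+> f (snd w)) \<inter> (N <+> {}) = S \<inter> (N <+> {})"
        using loc[OF _ sub] N by auto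
      then show "\<exists>x\<in>topspace X. e x \<inter> N = Inl -` S \<inter> N"
        by (intro bexI[of _ "fst w"]) (auto simp: Plus_Int_eq_iff vimage_Int mem_Times_iff)
    qed (use S in auto)
    moreover have "\<exists>y\<in>topspace Y. f y = Inr -` S"
    proof (rule Y.complete)
      fix N assume N: "finite N" "N \<subseteq> J"
      have sub: "{} <+> N \<subseteq> I <+> J"
        using N by blast
      obtain w where "w \<in> topspace (prod_topology X Y)"
        "(e (fst w) <+> f (snd w)) \<inter> ({} <+> N) = S \<inter> ({} <+> N)"
        using loc[OF _ sub] N by auto
      then show "\<exists>y\<in>topspace Y. f y \<inter> N = Inr -` S \<inter> N"
        by (intro bexI[of _ "snd w"]) (auto simp: Plus_Int_eq_iff vimage_Int mem_Times_iff)
    qed (use S in auto)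
    ultimately obtain x y where "x \<in> topspace X" "y \<in> topspace Y" "e x <+> f y = S"
      using sum_set_eq_iff by (metis vimage_Plus)
    then show "\<exists>w\<in>topspace (prod_topology X Y). e (fst w) <+> f (snd w) = S"
      by (intro bexI[of _ "(x, y)"]) auto
  qed
qed

lemma continuous_map_mem_pOrd:
  assumes "q \<in> carrier G \<times> carrier G"
  shows "continuous_map (pOrd_topology G) (discrete_topology UNIV) (\<lambda>r. q \<in> r)"
proof -
  let ?I = "carrier G \<times> carrier G"
  let ?ind = "\<lambda>r. \<lambda>p\<in>?I. p \<in> r"
  have "continuous_map (pOrd_topology G)
      (product_topology (\<lambda>_. discrete_topology (UNIV :: bool set)) ?I) ?ind"
    unfolding pOrd_topology_def
    using continuous_map_pullback[OF continuous_map_id, where A = "pOrd G" and f = ?ind]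
    by (simp add: id_def comp_def)
  then show ?thesis
    using continuous_map_componentwise[THEN iffD1] assms by fastforce
qed

text \<open>
  Relations are their own codes. They form a closed set because a failure of
  irreflexivity or transitivity is visible on at most three pairs; asymmetry follows from these two.
\<close>

lemma coordinates_pOrd:
  assumes "countable (carrier G)" "carrier G \<noteq> {}"
  shows "coordinates (pOrd_topology G) (carrier G \<times> carrier G) (\<lambda>r. r)"
proof
  let ?I = "carrier G \<times> carrier G"
  show "countable ?I" "?I \<noteq> {}" using assms by auto
  show "w \<subseteq> ?I" if "w \<in> topspace (pOrd_topology G)" for w
    using that by (auto simp: pOrd_def strict_orders_on_def)
  show "openin (pOrd_topology G) U \<longleftrightarrow> U \<subseteq> topspace (pOrd_topology G) \<and>
      (\<forall>w\<in>U. \<exists>N. finite N \<and> N \<subseteq> ?I \<and> (\<forall>v\<in>topspace (pOrd_topology G). v \<inter> N = w \<inter> N \<longrightarrow> v \<in> U))"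
    (is "?O \<longleftrightarrow> ?C") for U
  proof
    assume ?O
    show ?C
    proof (intro conjI ballI)
      show "U \<subseteq> topspace (pOrd_topology G)" using \<open>?O\<close> by (rule openin_subset)
      obtain V where V: "openin (product_topology (\<lambda>_. discrete_topology (UNIV :: bool set)) ?I) V"
        "U = (\<lambda>r. \<lambda>p\<in>?I. p \<in> r) -` V \<inter> pOrd G"
        using \<open>?O\<close> unfolding pOrd_topology_def openin_pullback_topology by blast
      fix w assume "w \<in> U"
      then have "(\<lambda>p\<in>?I. p \<in> w) \<in> V" using V(2) by auto
      then obtain W where W: "finite {q \<in> ?I. W q \<noteq> (UNIV :: bool set)}"
        "(\<lambda>p\<in>?I. p \<in> w) \<in> Pi\<^sub>E ?I W" "Pi\<^sub>E ?I W \<subseteq> V"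
        using V(1) unfolding openin_product_topology_alt by auto
      define N where "N = {q \<in> ?I. W q \<noteq> UNIV}"
      have "v \<in> U" if v: "v \<in> pOrd G" "v \<inter> N = w \<inter> N" for v
      proof -
        have "(q \<in> v) \<in> W q" if q: "q \<in> ?I" for q
        proof (cases "W q = UNIV")
          case False
          then have "q \<in> v \<longleftrightarrow> q \<in> w" using q v(2) by (auto simp: N_def)
          moreover have "(q \<in> w) \<in> W q" using W(2) q by (auto simp: PiE_iff)
          ultimately show ?thesis by simp
        qed simp
        then have "(\<lambda>p\<in>?I. p \<in> v) \<in> Pi\<^sub>E ?I W" by auto
        then have "(\<lambda>p\<in>?I. p \<in> v) \<in> V" by (rule subsetD[OF W(3)])
        then show ?thesis unfolding V(2) using v(1) by blast
      qed
      then show "\<exists>N. finite N \<and> N \<subseteq> ?I \<and> (\<forall>v\<in>topspace (pOrd_topology G). v \<inter> N = w \<inter> N \<longrightarrow> v \<in> U)"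
        using W(1) by (intro exI[of _ N]) (auto simp: N_def)
    qed
  next
    assume C: ?C
    show ?O
    proof (subst openin_subopen, intro ballI)
      fix w assume w: "w \<in> U"
      obtain N where N: "finite N" "N \<subseteq> ?I" "\<forall>v\<in>topspace (pOrd_topology G). v \<inter> N = w \<inter> N \<longrightarrow> v \<in> U"
        using C w by meson
      let ?T = "topspace (pOrd_topology G) \<inter> (\<Inter>q\<in>N. {v \<in> topspace (pOrd_topology G). (q \<in> v) \<in> {q \<in> w}})"
      have "openin (pOrd_topology G) {v \<in> topspace (pOrd_topology G). (q \<in> v) \<in> {q \<in> w}}"
        if "q \<in> N" for q
        using N(2) that by (intro openin_continuous_map_preimage[OF continuous_map_mem_pOrd]) auto
      then have "openin (pOrd_topology G) ?T"
        using N(1) by (cases "N = {}") (simp_all add: openin_Int openin_INT2 del: topspace_pOrd_topology)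
      moreover have "w \<in> ?T" using w C by auto
      moreover have "?T \<subseteq> U"
      proof
        fix v assume v: "v \<in> ?T"
        then have "v \<inter> N = w \<inter> N" by auto
        then show "v \<in> U" using N(3) v by auto
      qed
      ultimately show "\<exists>T. openin (pOrd_topology G) T \<and> w \<in> T \<and> T \<subseteq> U" by blast
    qed
  qed
  fix S assume S: "S \<subseteq> ?I"
    and loc: "\<And>N. finite N \<Longrightarrow> N \<subseteq> ?I \<Longrightarrow> \<exists>w\<in>topspace (pOrd_topology G). w \<inter> N = S \<inter> N"
  have "irrefl S"
    unfolding irrefl_def
  proof (intro allI notI)
    fix x assume x: "(x, x) \<in> S"
    obtain w where "w \<in> pOrd G" "w \<inter> {(x, x)} = S \<inter> {(x, x)}"
      using loc[of "{(x, x)}"] S x by auto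
    then show False using x by (auto simp: pOrd_def strict_orders_on_def irrefl_def)
  qed
  moreover have "trans S"
  proof (rule transI)
    fix x y z assume xyz: "(x, y) \<in> S" "(y, z) \<in> S"
    let ?N = "{(x, y), (y, z), (x, z)}"
    obtain w where w: "w \<in> pOrd G" "w \<inter> ?N = S \<inter> ?N"
      using loc[of ?N] S xyz by auto
    then have "(x, y) \<in> w" "(y, z) \<in> w" using xyz by auto
    then have "(x, z) \<in> w" using w(1) by (auto simp: pOrd_def strict_orders_on_def dest: transD)
    then show "(x, z) \<in> S" using w(2) by auto
  qed
  moreover from calculation have "asym S"
    by (auto simp: asym_iff irrefl_def dest: transD)
  ultimately show "\<exists>w\<in>topspace (pOrd_topology G). w = S"
    using S by (auto simp: pOrd_def strict_orders_on_def)
qed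

section \<open>Relatively independent joint probabilities\<close>

text \<open>
  Two probability spaces over a common base. The joint probability of an event \<open>A\<close> on the left and an event
  \<open>D\<close> on the right integrates the conditional probability of \<open>A\<close> given the base over \<open>D\<close>; it is the
  probability that makes both sides conditionally independent. No measure on the product is
  formed: the values on pairs of events are all that is used.
\<close>

locale relative_product =
  M: prob_space M + M': prob_space M'
  for M :: "'m measure" and Y :: "'m \<Rightarrow> 'b" and M' :: "'n measure" and Y' :: "'n \<Rightarrow> 'b"
    and B :: "'b measure" +
  assumes Y [measurable]: "Y \<in> measurable M B" and Y' [measurable]: "Y' \<in> measurable M' B"
    and same_law: "distr M B Y = distr M' B Y'"
begin

abbreviation base :: "'b measure" where
  "base \<equiv> distr M B Y"

sublocale base: prob_space base
  by (rule M.prob_space_distr) simp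

definition cond_prob :: "'m set \<Rightarrow> 'b \<Rightarrow> ennreal" where
  "cond_prob A = (SOME f. f \<in> borel_measurable B \<and>
     (\<forall>C\<in>sets B. (\<integral>\<^sup>+b. f b * indicator C b \<partial>base) = emeasure M (A \<inter> (Y -` C \<inter> space M))))"

definition joint :: "'m set \<Rightarrow> 'n set \<Rightarrow> ennreal" where
  "joint A D = (\<integral>\<^sup>+z. cond_prob A (Y' z) * indicator D z \<partial>M')"

lemma
  assumes A: "A \<in> sets M"
  shows cond_prob_measurable [measurable]: "cond_prob A \<in> borel_measurable B"
    and nn_integral_cond_prob: "\<And>C. C \<in> sets B \<Longrightarrow>
      (\<integral>\<^sup>+b. cond_prob A b * indicator C b \<partial>base) = emeasure M (A \<inter> (Y -` C \<inter> space M))"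
proof -
  let ?N = "distr (density M (indicator A)) B Y"
  have N: "emeasure ?N C = emeasure M (A \<inter> (Y -` C \<inter> space M))" if "C \<in> sets B" for C
    using that A by (simp add: emeasure_distr emeasure_density indicator_inter_arith[symmetric] Int_assoc)
  have "absolutely_continuous base ?N"
    unfolding absolutely_continuous_def
  proof
    fix C assume "C \<in> null_sets base"
    then have C: "C \<in> sets B" "emeasure M (Y -` C \<inter> space M) = 0"
      by (auto simp: null_sets_def emeasure_distr)
    have "emeasure M (A \<inter> (Y -` C \<inter> space M)) \<le> emeasure M (Y -` C \<inter> space M)"
      using C(1) by (intro emeasure_mono) auto
    then show "C \<in> null_sets ?N"
      using C N by (auto simp: null_sets_def)
  qed
  then obtain f where f: "f \<in> borel_measurable base" "density base f = ?N"
    using base.Radon_Nikodym[of ?N] by auto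
  have "(\<integral>\<^sup>+b. f b * indicator C b \<partial>base) = emeasure M (A \<inter> (Y -` C \<inter> space M))" if "C \<in> sets B" for C
    using f that N by (metis emeasure_density sets_distr)
  then have "\<exists>f. f \<in> borel_measurable B \<and>
     (\<forall>C\<in>sets B. (\<integral>\<^sup>+b. f b * indicator C b \<partial>base) = emeasure M (A \<inter> (Y -` C \<inter> space M)))"
    using f(1) by (intro exI[of _ f]) simp
  from someI_ex[OF this] show "cond_prob A \<in> borel_measurable B"
    "\<And>C. C \<in> sets B \<Longrightarrow>
      (\<integral>\<^sup>+b. cond_prob A b * indicator C b \<partial>base) = emeasure M (A \<inter> (Y -` C \<inter> space M))"
    unfolding cond_prob_def[symmetric] by auto
qed

text \<open>
  Conditional probabilities are determined up to null sets of the base, and those pull back to null sets of the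
  right-hand space because both spaces induce the same law on the base.
\<close>

lemma cond_prob_unique:
  assumes A: "A \<in> sets M" and f [measurable]: "f \<in> borel_measurable B"
    and eq: "\<And>C. C \<in> sets B \<Longrightarrow>
      (\<integral>\<^sup>+b. f b * indicator C b \<partial>base) = emeasure M (A \<inter> (Y -` C \<inter> space M))"
  shows "AE z in M'. cond_prob A (Y' z) = f (Y' z)"
proof -
  have [measurable]: "cond_prob A \<in> borel_measurable B"
    by (rule cond_prob_measurable[OF A])
  have "density base (cond_prob A) = density base f"
    by (rule measure_eqI) (simp_all add: emeasure_density nn_integral_cond_prob[OF A] eq)
  then have "AE b in base. cond_prob A b = f b"
    by (intro base.density_unique) simp_all
  then show ?thesis
    unfolding same_law by (rule AE_distrD[OF Y'])
qed

lemma joint_cong: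
  assumes "AE z in M'. cond_prob A (Y' z) = f (Y' z)"
  shows "joint A D = (\<integral>\<^sup>+z. f (Y' z) * indicator D z \<partial>M')"
  unfolding joint_def using assms by (intro nn_integral_cong_AE) auto

lemma joint_space_left:
  assumes "D \<in> sets M'"
  shows "joint (space M) D = emeasure M' D"
proof -
  have "AE z in M'. cond_prob (space M) (Y' z) = 1"
    by (rule cond_prob_unique[where f = "\<lambda>_. 1"]) (auto simp: emeasure_distr intro!: arg_cong[where f = "emeasure M"])
  then show ?thesis
    using assms joint_cong[of "space M" "\<lambda>_. 1"] by simp
qed

lemma joint_space_right:
  assumes A: "A \<in> sets M"
  shows "joint A (space M') = emeasure M A"
proof -
  note [measurable] = cond_prob_measurable[OF A]
  have "joint A (space M') = (\<integral>\<^sup>+z. cond_prob A (Y' z) \<partial>M')"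
    unfolding joint_def by (rule nn_integral_cong) simp
  also have "\<dots> = (\<integral>\<^sup>+b. cond_prob A b * indicator (space B) b \<partial>base)"
    unfolding same_law by (subst nn_integral_distr) (auto intro!: nn_integral_cong dest: measurable_space[OF Y'])
  also have "\<dots> = emeasure M A"
  proof -
    have "A \<inter> (Y -` space B \<inter> space M) = A"
      using sets.sets_into_space[OF A] measurable_space[OF Y] by auto
    then show ?thesis by (simp add: nn_integral_cond_prob[OF A])
  qed
  finally show ?thesis .
qed

lemma joint_mono_right: "D \<subseteq> D' \<Longrightarrow> joint A D \<le> joint A D'"
  unfolding joint_def by (intro nn_integral_mono) (auto simp: indicator_def)

lemma joint_le_one:
  assumes "A \<in> sets M" "D \<subseteq> space M'"
  shows "joint A D \<le> 1"
  using joint_mono_right[OF assms(2)] joint_space_right[OF assms(1)] M.emeasure_le_1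
  by (metis order_trans)

lemma joint_Un_left:
  assumes A: "A1 \<in> sets M" "A2 \<in> sets M" "A1 \<inter> A2 = {}" and [measurable]: "D \<in> sets M'"
  shows "joint (A1 \<union> A2) D = joint A1 D + joint A2 D"
proof -
  note [measurable] = cond_prob_measurable[OF A(1)] cond_prob_measurable[OF A(2)]
  have "AE z in M'. cond_prob (A1 \<union> A2) (Y' z) = cond_prob A1 (Y' z) + cond_prob A2 (Y' z)"
  proof (rule cond_prob_unique[where f = "\<lambda>b. cond_prob A1 b + cond_prob A2 b"])
    fix C assume C [measurable]: "C \<in> sets B"
    have "(A1 \<union> A2) \<inter> (Y -` C \<inter> space M) = (A1 \<inter> (Y -` C \<inter> space M)) \<union> (A2 \<inter> (Y -` C \<inter> space M))"
      by auto
    moreover have "(\<integral>\<^sup>+b. (cond_prob A1 b + cond_prob A2 b) * indicator C b \<partial>base) =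
        (\<integral>\<^sup>+b. cond_prob A1 b * indicator C b \<partial>base) + (\<integral>\<^sup>+b. cond_prob A2 b * indicator C b \<partial>base)"
      by (simp add: distrib_right nn_integral_add)
    ultimately show "(\<integral>\<^sup>+b. (cond_prob A1 b + cond_prob A2 b) * indicator C b \<partial>base) =
        emeasure M ((A1 \<union> A2) \<inter> (Y -` C \<inter> space M))"
      using A C by (simp add: nn_integral_cond_prob) (subst plus_emeasure, auto)
  qed (use A in auto)
  then show ?thesis
    using joint_cong[of "A1 \<union> A2" "\<lambda>b. cond_prob A1 b + cond_prob A2 b" D]
    by (simp add: joint_def distrib_right nn_integral_add)
qed

lemma joint_Un_right:
  assumes A: "A \<in> sets M" and [measurable]: "D1 \<in> sets M'" "D2 \<in> sets M'" and "D1 \<inter> D2 = {}"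
  shows "joint A (D1 \<union> D2) = joint A D1 + joint A D2"
proof -
  note [measurable] = cond_prob_measurable[OF A]
  have "joint A (D1 \<union> D2) =
      (\<integral>\<^sup>+z. cond_prob A (Y' z) * indicator D1 z + cond_prob A (Y' z) * indicator D2 z \<partial>M')"
    unfolding joint_def using assms(4) by (intro nn_integral_cong) (auto simp: indicator_def)
  then show ?thesis
    by (simp add: joint_def nn_integral_add)
qed

lemma joint_empty_left: "joint {} D = 0"
proof -
  have "AE z in M'. cond_prob {} (Y' z) = 0"
    by (rule cond_prob_unique[where f = "\<lambda>_. 0"]) auto
  then show ?thesis
    using joint_cong[of "{}" "\<lambda>_. 0"] by simp
qed

lemma joint_empty_right: "joint A {} = 0"
  by (simp add: joint_def)

text \<open>
  If \<open>A\<close> forces the base point into \<open>C\<close> while \<open>D\<close> forces it out of \<open>C\<close>, the two events exclude each other.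
  For orders, with \<open>C\<close> the event that a given pair is in the middle order, this is how
  nestedness passes through the middle order.
\<close>

lemma joint_eq_zero:
  assumes A: "A \<in> sets M" and D [measurable]: "D \<in> sets M'" and C [measurable]: "C \<in> sets B"
    and left: "emeasure M (A \<inter> (Y -` (space B - C) \<inter> space M)) = 0"
    and right: "emeasure M' (D \<inter> (Y' -` C \<inter> space M')) = 0"
  shows "joint A D = 0"
proof -
  note [measurable] = cond_prob_measurable[OF A]
  have "AE z in M'. z \<notin> D \<inter> (Y' -` C \<inter> space M')"
    using right by (intro AE_not_in) (auto simp: null_sets_def)
  then have "AE z in M'. cond_prob A (Y' z) * indicator D z
      \<le> cond_prob A (Y' z) * indicator (space B - C) (Y' z)"
    by (rule AE_mp) (auto intro!: AE_I2 simp: indicator_def dest: measurable_space[OF Y'])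
  then have "joint A D \<le> (\<integral>\<^sup>+z. cond_prob A (Y' z) * indicator (space B - C) (Y' z) \<partial>M')"
    unfolding joint_def by (rule nn_integral_mono_AE)
  also have "\<dots> = (\<integral>\<^sup>+b. cond_prob A b * indicator (space B - C) b \<partial>base)"
    unfolding same_law by (subst nn_integral_distr) auto
  also have "\<dots> = 0"
    using left by (simp add: nn_integral_cond_prob[OF A])
  finally show ?thesis by simp
qed

text \<open>
  Measure-preserving maps of both spaces that act compatibly on the base carry conditional
  probabilities to conditional probabilities, by their uniqueness. The left inverse \<open>k\<close> of \<open>h\<close> makes
  every event of the base a preimage under \<open>h\<close>.
\<close>

lemma joint_invariant:
  assumes g [measurable]: "g \<in> measurable M M" and g_law: "distr M M g = M"
    and g' [measurable]: "g' \<in> measurable M' M'" and g'_law: "distr M' M' g' = M'"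
    and h [measurable]: "h \<in> measurable B B" and k [measurable]: "k \<in> measurable B B"
    and kh: "\<And>b. b \<in> space B \<Longrightarrow> k (h b) = b"
    and Yg: "\<And>x. x \<in> space M \<Longrightarrow> Y (g x) = h (Y x)"
    and Y'g': "\<And>z. z \<in> space M' \<Longrightarrow> Y' (g' z) = h (Y' z)"
    and A [measurable]: "A \<in> sets M" and D [measurable]: "D \<in> sets M'"
  shows "joint (g -` A \<inter> space M) (g' -` D \<inter> space M') = joint A D"
proof -
  note [measurable] = cond_prob_measurable[OF A]
  have "distr base B h = distr M B (\<lambda>x. h (Y x))"
    by (simp add: distr_distr comp_def)
  also have "\<dots> = distr M B (\<lambda>x. Y (g x))"
    by (rule distr_cong) (auto simp: Yg)
  also have "\<dots> = distr (distr M M g) B Y"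
    by (simp add: distr_distr comp_def)
  finally have h_law: "distr base B h = base"
    by (simp add: g_law)
  have "AE z in M'. cond_prob (g -` A \<inter> space M) (Y' z) = cond_prob A (h (Y' z))"
  proof (rule cond_prob_unique[where f = "\<lambda>b. cond_prob A (h b)"])
    fix C assume C [measurable]: "C \<in> sets B"
    have "(\<integral>\<^sup>+b. cond_prob A (h b) * indicator C b \<partial>base) =
        (\<integral>\<^sup>+b. cond_prob A (h b) * indicator (k -` C \<inter> space B) (h b) \<partial>base)"
      by (rule nn_integral_cong) (auto simp: indicator_def kh dest: measurable_space[OF h])
    also have "\<dots> = (\<integral>\<^sup>+b. cond_prob A b * indicator (k -` C \<inter> space B) b \<partial>distr base B h)"
      by (subst nn_integral_distr) auto
    also have "\<dots> = emeasure M (A \<inter> (Y -` (k -` C \<inter> space B) \<inter> space M))"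
      unfolding h_law by (rule nn_integral_cond_prob[OF A]) measurable
    also have "\<dots> = emeasure (distr M M g) (A \<inter> (Y -` (k -` C \<inter> space B) \<inter> space M))"
      by (simp add: g_law)
    also have "\<dots> = emeasure M (g -` (A \<inter> (Y -` (k -` C \<inter> space B) \<inter> space M)) \<inter> space M)"
      by (rule emeasure_distr) auto
    also have "g -` (A \<inter> (Y -` (k -` C \<inter> space B) \<inter> space M)) \<inter> space M =
        (g -` A \<inter> space M) \<inter> (Y -` C \<inter> space M)"
      using measurable_space[OF g] measurable_space[OF Y] measurable_space[OF h]
      by (auto simp: Yg kh)
    finally show "(\<integral>\<^sup>+b. cond_prob A (h b) * indicator C b \<partial>base) =
        emeasure M ((g -` A \<inter> space M) \<inter> (Y -` C \<inter> space M))" .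
  qed auto
  then have "joint (g -` A \<inter> space M) (g' -` D \<inter> space M') =
      (\<integral>\<^sup>+z. cond_prob A (h (Y' z)) * indicator (g' -` D \<inter> space M') z \<partial>M')"
    using joint_cong[of "g -` A \<inter> space M" "\<lambda>b. cond_prob A (h b)"] by simp
  also have "\<dots> = (\<integral>\<^sup>+z. cond_prob A (Y' (g' z)) * indicator D (g' z) \<partial>M')"
    by (rule nn_integral_cong) (auto simp: Y'g' indicator_def)
  also have "\<dots> = (\<integral>\<^sup>+z. cond_prob A (Y' z) * indicator D z \<partial>distr M' M' g')"
    by (subst nn_integral_distr) auto
  finally show ?thesis
    by (simp add: g'_law joint_def)
qed

end

section \<open>Joinings of invariant random orders\<close>

locale countable_group = group G for G (structure) +
  assumes countable_carrier: "countable (carrier G)"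
begin

abbreviation pairs :: "'a rel" where
  "pairs \<equiv> carrier G \<times> carrier G"

sublocale ord: coordinates "pOrd_topology G" pairs "\<lambda>r. r"
  by (rule coordinates_pOrd[OF countable_carrier carrier_not_empty])

sublocale pair: coordinates "pOrd_pair_topology G" "pairs <+> pairs" "\<lambda>w. fst w <+> snd w"
  by (rule coordinates_prod[OF ord.coordinates_axioms ord.coordinates_axioms])

definition joining :: "('a rel \<times> 'a rel) measure \<Rightarrow> bool" where
  "joining \<mu> \<longleftrightarrow> borel_prob (pOrd_pair_topology G) \<mu> \<and>
     (\<forall>g\<in>carrier G.
        distr \<mu> (borel_space (pOrd_pair_topology G)) (map_prod (r_act G g) (r_act G g)) = \<mu>) \<and>
     (AE (r\<^sub>1, r\<^sub>2) in \<mu>. r\<^sub>1 \<subseteq> r\<^sub>2)"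

abbreviation margin1 :: "('a rel \<times> 'a rel) measure \<Rightarrow> 'a rel measure" where
  "margin1 \<mu> \<equiv> distr \<mu> (borel_space (pOrd_topology G)) fst"

abbreviation margin2 :: "('a rel \<times> 'a rel) measure \<Rightarrow> 'a rel measure" where
  "margin2 \<mu> \<equiv> distr \<mu> (borel_space (pOrd_topology G)) snd"

lemma ext_le_iff: "ext_le G \<nu>1 \<nu>2 \<longleftrightarrow> (\<exists>\<mu>. joining \<mu> \<and> margin1 \<mu> = \<nu>1 \<and> margin2 \<mu> = \<nu>2)"
  by (auto simp: ext_le_def joining_def)

definition translate :: "'a \<Rightarrow> 'a \<times> 'a \<Rightarrow> 'a \<times> 'a" where
  "translate g = map_prod (\<lambda>x. x \<otimes> g) (\<lambda>x. x \<otimes> g)"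

abbreviation translate_pair :: "'a \<Rightarrow> ('a \<times> 'a) + ('a \<times> 'a) \<Rightarrow> ('a \<times> 'a) + ('a \<times> 'a)" where
  "translate_pair g \<equiv> map_sum (translate g) (translate g)"

lemma translate_pairs:
  assumes "g \<in> carrier G"
  shows "inj_on (translate g) pairs" "translate g \<in> pairs \<rightarrow> pairs"
    "inj_on (translate_pair g) (pairs <+> pairs)"
    "translate_pair g \<in> pairs <+> pairs \<rightarrow> pairs <+> pairs"
proof -
  show inj: "inj_on (translate g) pairs" and "translate g \<in> pairs \<rightarrow> pairs"
    using assms by (auto simp: translate_def inj_on_def)
  then show "translate_pair g \<in> pairs <+> pairs \<rightarrow> pairs <+> pairs"
    by (auto simp: Pi_iff)
  show "inj_on (translate_pair g) (pairs <+> pairs)"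
    using inj by (auto simp: inj_on_def)
qed

lemma mem_r_act_iff: "q \<in> pairs \<Longrightarrow> q \<in> r_act G g r \<longleftrightarrow> translate g q \<in> r"
  by (auto simp: r_act_def translate_def)

lemma mem_r_act_pair_iff:
  assumes "q \<in> pairs <+> pairs"
  shows "q \<in> fst (map_prod (r_act G g) (r_act G g) w) <+> snd (map_prod (r_act G g) (r_act G g) w)
    \<longleftrightarrow> translate_pair g q \<in> fst w <+> snd w"
  using assms by (cases w) (auto simp: mem_r_act_iff)

lemma invariant_order_iff:
  assumes "borel_prob (pOrd_topology G) \<nu>" "g \<in> carrier G"
  shows "distr \<nu> (borel_space (pOrd_topology G)) (r_act G g) = \<nu> \<longleftrightarrow>
    (\<forall>N E. finite N \<and> N \<subseteq> pairs \<and> E \<subseteq> N \<longrightarrow>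
       measure \<nu> (ord.cyl (translate g ` N) (translate g ` E)) = measure \<nu> (ord.cyl N E))"
  by (rule ord.invariant_iff_cyl[OF assms(1) continuous_map_r_act[OF assms(2)]
        translate_pairs(1,2)[OF assms(2)] mem_r_act_iff])

lemma invariant_pair_iff:
  assumes "borel_prob (pOrd_pair_topology G) \<mu>" "g \<in> carrier G"
  shows "distr \<mu> (borel_space (pOrd_pair_topology G)) (map_prod (r_act G g) (r_act G g)) = \<mu> \<longleftrightarrow>
    (\<forall>N E. finite N \<and> N \<subseteq> pairs <+> pairs \<and> E \<subseteq> N \<longrightarrow>
       measure \<mu> (pair.cyl (translate_pair g ` N) (translate_pair g ` E)) = measure \<mu> (pair.cyl N E))"
  by (rule pair.invariant_iff_cyl[OF assms(1) continuous_map_r_act_pair[OF assms(2)]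
        translate_pairs(3,4)[OF assms(2)] mem_r_act_pair_iff])

lemma pair_cyl_Inl: "pair.cyl (Inl ` N) (Inl ` E) = ord.cyl N E \<times> pOrd G"
proof -
  have [simp]: "Inl -` (Inl ` A) = A" "Inr -` (Inl ` A) = {}" for A :: "'a rel"
    by auto
  show ?thesis
    by (auto simp: pair.cyl_def ord.cyl_def Plus_Int_eq_iff)
qed

lemma pair_cyl_Inr: "pair.cyl (Inr ` N) (Inr ` E) = pOrd G \<times> ord.cyl N E"
proof -
  have [simp]: "Inr -` (Inr ` A) = A" "Inl -` (Inr ` A) = {}" for A :: "'a rel"
    by auto
  show ?thesis
    by (auto simp: pair.cyl_def ord.cyl_def Plus_Int_eq_iff)
qed

lemma borel_prob_space:
  assumes "borel_prob X \<mu>"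
  shows "space \<mu> = topspace X"
  using assms by (metis borel_prob_def sets_eq_imp_space_eq space_borel_space)

lemma measurable_margins:
  assumes "borel_prob (pOrd_pair_topology G) \<mu>"
  shows "fst \<in> measurable \<mu> (borel_space (pOrd_topology G))"
    "snd \<in> measurable \<mu> (borel_space (pOrd_topology G))"
  using continuous_map_measurable[OF continuous_map_fst, of "pOrd_topology G" "pOrd_topology G"]
    continuous_map_measurable[OF continuous_map_snd, of "pOrd_topology G" "pOrd_topology G"] assms
  by (simp_all add: borel_prob_def cong: measurable_cong_sets)

lemma borel_prob_margins:
  assumes "borel_prob (pOrd_pair_topology G) \<mu>"
  shows "borel_prob (pOrd_topology G) (margin1 \<mu>)" "borel_prob (pOrd_topology G) (margin2 \<mu>)"
  using measurable_margins[OF assms] assms by (auto simp: borel_prob_def prob_space.prob_space_distr)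

lemma measure_margin_cyl:
  assumes \<mu>: "borel_prob (pOrd_pair_topology G) \<mu>" and N: "finite N" "N \<subseteq> pairs"
  shows "measure (margin1 \<mu>) (ord.cyl N E) = measure \<mu> (pair.cyl (Inl ` N) (Inl ` E))"
    "measure (margin2 \<mu>) (ord.cyl N E) = measure \<mu> (pair.cyl (Inr ` N) (Inr ` E))"
proof -
  note cyl = ord.sets_cyl[OF refl N, of E]
  have "ord.cyl N E \<subseteq> pOrd G" by (auto simp: ord.cyl_def)
  then have "fst -` ord.cyl N E \<inter> space \<mu> = ord.cyl N E \<times> pOrd G"
    "snd -` ord.cyl N E \<inter> space \<mu> = pOrd G \<times> ord.cyl N E"
    using borel_prob_space[OF \<mu>] by auto
  then show "measure (margin1 \<mu>) (ord.cyl N E) = measure \<mu> (pair.cyl (Inl ` N) (Inl ` E))"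
    "measure (margin2 \<mu>) (ord.cyl N E) = measure \<mu> (pair.cyl (Inr ` N) (Inr ` E))"
    by (simp_all add: measure_distr[OF measurable_margins(1)[OF \<mu>] cyl]
      measure_distr[OF measurable_margins(2)[OF \<mu>] cyl] pair_cyl_Inl pair_cyl_Inr)
qed

lemma IRO_margins:
  assumes "joining \<mu>"
  shows "IRO G (margin1 \<mu>)" "IRO G (margin2 \<mu>)"
proof -
  have \<mu>: "borel_prob (pOrd_pair_topology G) \<mu>" using assms by (simp add: joining_def)
  have inv: "measure \<mu> (pair.cyl (translate_pair g ` N) (translate_pair g ` E)) = measure \<mu> (pair.cyl N E)"
    if "g \<in> carrier G" "finite N" "N \<subseteq> pairs <+> pairs" "E \<subseteq> N" for g N E
  proof -
    have "distr \<mu> (borel_space (pOrd_pair_topology G)) (map_prod (r_act G g) (r_act G g)) = \<mu>"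
      using assms that(1) by (simp add: joining_def)
    then show ?thesis
      using that(2-) unfolding invariant_pair_iff[OF \<mu> that(1)] by simp
  qed
  have "distr (margin1 \<mu>) (borel_space (pOrd_topology G)) (r_act G g) = margin1 \<mu> \<and>
      distr (margin2 \<mu>) (borel_space (pOrd_topology G)) (r_act G g) = margin2 \<mu>"
    if g: "g \<in> carrier G" for g
  proof -
    have "measure (margin1 \<mu>) (ord.cyl (translate g ` N) (translate g ` E)) = measure (margin1 \<mu>) (ord.cyl N E)
      \<and> measure (margin2 \<mu>) (ord.cyl (translate g ` N) (translate g ` E)) = measure (margin2 \<mu>) (ord.cyl N E)"
      if N: "finite N" "N \<subseteq> pairs" "E \<subseteq> N" for N E
    proof -
      have "finite (translate g ` N)" "translate g ` N \<subseteq> pairs"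
        using N(1,2) funcset_mem[OF translate_pairs(2)[OF g]] by blast+
      moreover have "translate_pair g ` Inl ` A = Inl ` translate g ` A"
        "translate_pair g ` Inr ` A = Inr ` translate g ` A" for A :: "'a rel"
        by (auto simp: image_image)
      moreover have "Inl ` N \<subseteq> pairs <+> pairs" "Inr ` N \<subseteq> pairs <+> pairs"
        using N(2) by auto
      ultimately show ?thesis
        using N inv[OF g, of "Inl ` N" "Inl ` E"] inv[OF g, of "Inr ` N" "Inr ` E"]
        by (simp add: measure_margin_cyl[OF \<mu>] image_mono)
    qed
    then show ?thesis
      using invariant_order_iff[OF borel_prob_margins(1)[OF \<mu>] g]
        invariant_order_iff[OF borel_prob_margins(2)[OF \<mu>] g] by simp
  qed
  then show "IRO G (margin1 \<mu>)" "IRO G (margin2 \<mu>)"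
    using borel_prob_margins[OF \<mu>] by (auto simp: IRO_def)
qed

text \<open>
  A pair of orders fails to be nested exactly when it lies in one of these cylinders, so nestedness is a
  vanishing condition on countably many weights.
\<close>

lemma pair_cyl_unnested: "pair.cyl {Inl q, Inr q} {Inl q} = {w \<in> pOrd G \<times> pOrd G. q \<in> fst w - snd w}"
proof -
  have "(A <+> B) \<inter> {Inl q, Inr q} = {Inl q} \<longleftrightarrow> q \<in> A - B" for A B :: "'a rel"
    by blast
  then show ?thesis
    by (simp add: pair.cyl_def)
qed

lemma Inl_Inr_subset: "q \<in> pairs \<Longrightarrow> {Inl q, Inr q} \<subseteq> pairs <+> pairs"
  by blast

lemma nested_iff_cyl:
  assumes \<mu>: "borel_prob (pOrd_pair_topology G) \<mu>"
  shows "(AE (r\<^sub>1, r\<^sub>2) in \<mu>. r\<^sub>1 \<subseteq> r\<^sub>2) \<longleftrightarrow>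
    (\<forall>q\<in>pairs. measure \<mu> (pair.cyl {Inl q, Inr q} {Inl q}) = 0)"
proof -
  interpret prob_space \<mu> using \<mu> by (simp add: borel_prob_def)
  have sets: "pair.cyl {Inl q, Inr q} {Inl q} \<in> sets \<mu>" if "q \<in> pairs" for q
    using \<mu> by (intro pair.sets_cyl Inl_Inr_subset that) (simp_all add: borel_prob_def)
  have mem: "w \<in> pair.cyl {Inl q, Inr q} {Inl q} \<longleftrightarrow> q \<in> fst w - snd w" if "w \<in> space \<mu>" for w q
    using that borel_prob_space[OF \<mu>] by (simp add: pair_cyl_unnested)
  have "(AE (r\<^sub>1, r\<^sub>2) in \<mu>. r\<^sub>1 \<subseteq> r\<^sub>2) \<longleftrightarrow>
      (AE w in \<mu>. \<forall>q\<in>pairs. w \<notin> pair.cyl {Inl q, Inr q} {Inl q})"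
  proof (rule AE_cong)
    fix w assume w: "w \<in> space \<mu>"
    then have "w \<in> pOrd G \<times> pOrd G"
      using borel_prob_space[OF \<mu>] by simp
    then have "fst w \<in> topspace (pOrd_topology G)"
      by (simp add: mem_Times_iff)
    then have "fst w \<subseteq> pairs"
      by (rule ord.coord_subset)
    then show "(case w of (r\<^sub>1, r\<^sub>2) \<Rightarrow> r\<^sub>1 \<subseteq> r\<^sub>2) \<longleftrightarrow> (\<forall>q\<in>pairs. w \<notin> pair.cyl {Inl q, Inr q} {Inl q})"
      using mem[OF w] by (auto simp: case_prod_beta)
  qed
  also have "\<dots> \<longleftrightarrow> (\<forall>q\<in>pairs. AE w in \<mu>. w \<notin> pair.cyl {Inl q, Inr q} {Inl q})"
    using ord.countable_index by (rule AE_ball_countable)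
  also have "\<dots> \<longleftrightarrow> (\<forall>q\<in>pairs. measure \<mu> (pair.cyl {Inl q, Inr q} {Inl q}) = 0)"
  proof (intro ball_cong refl)
    fix q assume "q \<in> pairs"
    then show "(AE w in \<mu>. w \<notin> pair.cyl {Inl q, Inr q} {Inl q}) \<longleftrightarrow>
        measure \<mu> (pair.cyl {Inl q, Inr q} {Inl q}) = 0"
      using AE_iff_null_sets[OF sets[of q]] sets[of q] by (simp add: null_sets_def emeasure_eq_measure)
  qed
  finally show ?thesis .
qed

text \<open>
  Every condition involves finitely many values of \<open>p\<close> only, and all of them are equations or weak
  inequalities; this is what makes the set of all such \<open>p\<close> closed for pointwise convergence.
\<close>

definition joining_weights ::
    "((('a \<times> 'a) + ('a \<times> 'a)) set \<Rightarrow> (('a \<times> 'a) + ('a \<times> 'a)) set \<Rightarrow> real) \<Rightarrow> bool" where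
  "joining_weights p \<longleftrightarrow> cylinder_weights (pairs <+> pairs) p \<and>
     (\<forall>N E. finite N \<and> N \<subseteq> pairs <+> pairs \<and> E \<subseteq> N \<longrightarrow>
        (pair.cyl N E = {} \<longrightarrow> p N E = 0) \<and>
        (\<forall>g\<in>carrier G. p (translate_pair g ` N) (translate_pair g ` E) = p N E)) \<and>
     (\<forall>q\<in>pairs. p {Inl q, Inr q} {Inl q} = 0)"

lemma joining_weights_joining:
  assumes "joining \<mu>"
  shows "joining_weights (\<lambda>N E. measure \<mu> (pair.cyl N E))"
proof -
  have \<mu>: "borel_prob (pOrd_pair_topology G) \<mu>" using assms by (simp add: joining_def)
  show ?thesis
    unfolding joining_weights_def
    using pair.cylinder_weights_measure[OF \<mu>] assms invariant_pair_iff[OF \<mu>] nested_iff_cyl[OF \<mu>]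
    by (auto simp: joining_def)
qed

lemma joining_with_weights:
  assumes p: "joining_weights p"
  obtains \<mu> where "joining \<mu>"
    "\<And>N E. finite N \<Longrightarrow> N \<subseteq> pairs <+> pairs \<Longrightarrow> E \<subseteq> N \<Longrightarrow> measure \<mu> (pair.cyl N E) = p N E"
proof -
  obtain \<mu> where \<mu>: "borel_prob (pOrd_pair_topology G) \<mu>"
    and law: "\<And>N E. finite N \<Longrightarrow> N \<subseteq> pairs <+> pairs \<Longrightarrow> E \<subseteq> N \<Longrightarrow> measure \<mu> (pair.cyl N E) = p N E"
    using p by (elim pair.measure_with_cylinder_weights[rotated -1]) (auto simp: joining_weights_def)
  have "distr \<mu> (borel_space (pOrd_pair_topology G)) (map_prod (r_act G g) (r_act G g)) = \<mu>"
    if g: "g \<in> carrier G" for g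
    unfolding invariant_pair_iff[OF \<mu> g]
  proof (intro allI impI, elim conjE)
    fix N E assume N: "finite N" "N \<subseteq> pairs <+> pairs" "E \<subseteq> N"
    then have "measure \<mu> (pair.cyl (translate_pair g ` N) (translate_pair g ` E)) =
        p (translate_pair g ` N) (translate_pair g ` E)"
      using translate_pairs(4)[OF g] by (intro law) auto
    then show "measure \<mu> (pair.cyl (translate_pair g ` N) (translate_pair g ` E)) = measure \<mu> (pair.cyl N E)"
      using p g N law[OF N] by (simp add: joining_weights_def)
  qed
  moreover have "AE (r\<^sub>1, r\<^sub>2) in \<mu>. r\<^sub>1 \<subseteq> r\<^sub>2"
    unfolding nested_iff_cyl[OF \<mu>]
  proof
    fix q assume q: "q \<in> pairs"
    have "\<forall>q\<in>pairs. p {Inl q, Inr q} {Inl q} = 0"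
      using p unfolding joining_weights_def by (elim conjE)
    from bspec[OF this q] show "measure \<mu> (pair.cyl {Inl q, Inr q} {Inl q}) = 0"
      using law[OF _ Inl_Inr_subset[OF q], of "{Inl q}"] by simp
  qed
  ultimately have "joining \<mu>"
    using \<mu> by (simp add: joining_def)
  then show ?thesis
    using law by (rule that)
qed

lemma joining_diagonal:
  assumes "IRO G \<nu>"
  obtains \<mu> where "joining \<mu>" "margin1 \<mu> = \<nu>"
proof -
  have \<nu>: "borel_prob (pOrd_topology G) \<nu>" using assms by (simp add: IRO_def)
  interpret prob_space \<nu> using \<nu> by (simp add: borel_prob_def)
  let ?P = "borel_space (pOrd_pair_topology G)" and ?d = "\<lambda>r::'a rel. (r, r)"
  have sets: "sets \<nu> = sets (borel_space (pOrd_topology G))" using \<nu> by (simp add: borel_prob_def)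
  have d: "?d \<in> measurable \<nu> ?P"
    using continuous_map_measurable[of "pOrd_topology G" "pOrd_pair_topology G" ?d] sets
    by (simp add: continuous_map_pairedI cong: measurable_cong_sets)
  define \<mu> where "\<mu> = distr \<nu> ?P ?d"
  have \<mu>: "borel_prob (pOrd_pair_topology G) \<mu>"
    using d by (simp add: \<mu>_def borel_prob_def prob_space_distr)
  have "distr \<mu> ?P (map_prod (r_act G g) (r_act G g)) = \<mu>" if g: "g \<in> carrier G" for g
  proof -
    have act: "r_act G g \<in> measurable \<nu> (borel_space (pOrd_topology G))"
      using continuous_map_measurable[OF continuous_map_r_act[OF g]] sets by (simp cong: measurable_cong_sets)
    have d': "?d \<in> measurable (borel_space (pOrd_topology G)) ?P"
      using d sets by (simp cong: measurable_cong_sets)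
    have "distr \<mu> ?P (map_prod (r_act G g) (r_act G g)) =
        distr \<nu> ?P (map_prod (r_act G g) (r_act G g) \<circ> ?d)"
      unfolding \<mu>_def
      by (rule distr_distr[OF continuous_map_measurable[OF continuous_map_r_act_pair[OF g]] d])
    also have "\<dots> = distr \<nu> ?P (?d \<circ> r_act G g)"
      by (simp add: comp_def)
    also have "\<dots> = distr (distr \<nu> (borel_space (pOrd_topology G)) (r_act G g)) ?P ?d"
      by (rule distr_distr[OF d' act, symmetric])
    also have "\<dots> = \<mu>"
      using assms g by (simp add: IRO_def \<mu>_def)
    finally show ?thesis .
  qed
  moreover have "AE (r\<^sub>1, r\<^sub>2) in \<mu>. r\<^sub>1 \<subseteq> r\<^sub>2"
    unfolding nested_iff_cyl[OF \<mu>]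
  proof
    fix q assume q: "q \<in> pairs"
    have "?d -` pair.cyl {Inl q, Inr q} {Inl q} \<inter> space \<nu> = {}"
      by (auto simp: pair_cyl_unnested)
    then show "measure \<mu> (pair.cyl {Inl q, Inr q} {Inl q}) = 0"
      unfolding \<mu>_def by (simp add: measure_distr[OF d pair.sets_cyl[OF refl _ Inl_Inr_subset[OF q]]])
  qed
  ultimately have "joining \<mu>"
    using \<mu> by (simp add: joining_def)
  moreover have "margin1 \<mu> = \<nu>"
    unfolding \<mu>_def using measurable_margins(1)[OF \<mu>] d sets
    by (subst distr_distr) (auto simp: comp_def \<mu>_def distr_id2 cong: measurable_cong_sets)
  ultimately show ?thesis by (rule that)
qed

end

section \<open>Composition of joinings\<close>

lemma vimage_map_sum:
  "Inl -` (map_sum f g ` F) = f ` (Inl -` F)" "Inr -` (map_sum f g ` F) = g ` (Inr -` F)"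
proof -
  have "Inl q \<in> map_sum f g ` F \<longleftrightarrow> q \<in> f ` (Inl -` F)" for q
  proof
    assume "Inl q \<in> map_sum f g ` F"
    then obtain x where "x \<in> F" "Inl q = map_sum f g x" by (rule imageE)
    then show "q \<in> f ` (Inl -` F)" by (cases x) auto
  next
    assume "q \<in> f ` (Inl -` F)"
    then obtain y where "Inl y \<in> F" "q = f y" by auto
    then show "Inl q \<in> map_sum f g ` F" by (metis image_eqI map_sum.simps(1))
  qed
  then show "Inl -` (map_sum f g ` F) = f ` (Inl -` F)" by (intro Set.set_eqI) (simp only: vimage_eq)
  have "Inr q \<in> map_sum f g ` F \<longleftrightarrow> q \<in> g ` (Inr -` F)" for q
  proof
    assume "Inr q \<in> map_sum f g ` F"
    then obtain x where "x \<in> F" "Inr q = map_sum f g x" by (rule imageE)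
    then show "q \<in> g ` (Inr -` F)" by (cases x) auto
  next
    assume "q \<in> g ` (Inr -` F)"
    then obtain y where "Inr y \<in> F" "q = g y" by auto
    then show "Inr q \<in> map_sum f g ` F" by (metis image_eqI map_sum.simps(2))
  qed
  then show "Inr -` (map_sum f g ` F) = g ` (Inr -` F)" by (intro Set.set_eqI) (simp only: vimage_eq)
qed

context countable_group
begin

lemma r_act_inv:
  assumes "g \<in> carrier G" "r \<in> pOrd G"
  shows "r_act G (inv g) (r_act G g r) = r"
proof -
  have "x \<otimes> inv g \<otimes> g = x" if "x \<in> carrier G" for x
    using that assms(1) by (simp add: m_assoc)
  moreover have "r \<subseteq> pairs"
    using assms(2) by (auto simp: pOrd_def strict_orders_on_def)
  ultimately show ?thesis
    using assms(1) by (auto simp: r_act_def)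
qed

text \<open>
  The weights of the composed joining are the joint probabilities of the relatively independent joining
  over the middle order: the left part of a pattern is an event for the first coordinate of \<open>\<mu>1\<close>, the
  right part an event for the second coordinate of \<open>\<mu>2\<close>.
\<close>

lemma joining_compose:
  assumes \<mu>1: "joining \<mu>1" and \<mu>2: "joining \<mu>2" and same: "margin2 \<mu>1 = margin1 \<mu>2"
  obtains \<mu> where "joining \<mu>" "margin1 \<mu> = margin1 \<mu>1" "margin2 \<mu> = margin2 \<mu>2"
proof -
  let ?B = "borel_space (pOrd_topology G)"
  have prob: "borel_prob (pOrd_pair_topology G) \<mu>1" "borel_prob (pOrd_pair_topology G) \<mu>2"
    using \<mu>1 \<mu>2 by (simp_all add: joining_def)
  have sets: "sets \<mu>1 = sets (borel_space (pOrd_pair_topology G))"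
    "sets \<mu>2 = sets (borel_space (pOrd_pair_topology G))"
    using prob by (simp_all add: borel_prob_def)
  have space: "space \<mu>1 = pOrd G \<times> pOrd G" "space \<mu>2 = pOrd G \<times> pOrd G"
    using borel_prob_space[OF prob(1)] borel_prob_space[OF prob(2)] by simp_all
  interpret R: relative_product \<mu>1 snd \<mu>2 fst ?B
    using prob measurable_margins[OF prob(1)] measurable_margins[OF prob(2)] same
    by (intro relative_product.intro relative_product_axioms.intro) (auto simp: borel_prob_def)
  define A where "A N E = ord.cyl (Inl -` N) (Inl -` E) \<times> pOrd G" for N E :: "(('a \<times> 'a) + ('a \<times> 'a)) set"
  define D where "D N E = pOrd G \<times> ord.cyl (Inr -` N) (Inr -` E)" for N E :: "(('a \<times> 'a) + ('a \<times> 'a)) set"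
  define p where "p N E = enn2real (R.joint (A N E) (D N E))" for N E
  have vimage: "finite (Inl -` N)" "Inl -` N \<subseteq> pairs" "finite (Inr -` N)" "Inr -` N \<subseteq> pairs"
    if "finite N" "N \<subseteq> pairs <+> pairs" for N :: "(('a \<times> 'a) + ('a \<times> 'a)) set"
    using that by (auto intro!: finite_vimageI)
  have meas: "A N E \<in> sets \<mu>1" "D N E \<in> sets \<mu>2"
    if N: "finite N" "N \<subseteq> pairs <+> pairs" for N E
  proof -
    have "Inl ` (Inl -` N) \<subseteq> pairs <+> pairs" "Inr ` (Inr -` N) \<subseteq> pairs <+> pairs"
      using N(2) by auto
    then show "A N E \<in> sets \<mu>1" "D N E \<in> sets \<mu>2"
      unfolding A_def D_def pair_cyl_Inl[symmetric] pair_cyl_Inr[symmetric]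
      using vimage[OF N] by (simp_all add: pair.sets_cyl sets del: image_vimage_eq)
  qed
  have fin: "R.joint (A N E) (D N E) < \<top>" if N: "finite N" "N \<subseteq> pairs <+> pairs" for N E
  proof -
    have "R.joint (A N E) (D N E) \<le> 1"
      using meas[OF N] by (intro R.joint_le_one sets.sets_into_space) auto
    then show ?thesis
      by (rule le_less_trans) simp
  qed
  have cyl_sub: "ord.cyl N E \<subseteq> pOrd G" for N E
    by (auto simp: ord.cyl_def)
  have cyl_empty: "ord.cyl {} {} = pOrd G"
    by (simp add: ord.cyl_def)
  have "cylinder_weights (pairs <+> pairs) p"
    unfolding cylinder_weights_def
  proof (intro conjI allI impI ballI; (elim conjE)?)
    have "A {} {} = space \<mu>1" "D {} {} = space \<mu>2"
      by (simp_all add: A_def D_def cyl_empty space)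
    then show "p {} {} = 1"
      using R.joint_space_right[of "space \<mu>1"] R.M.emeasure_space_1 by (simp add: p_def)
    fix N E :: "(('a \<times> 'a) + ('a \<times> 'a)) set" assume N: "finite N" "N \<subseteq> pairs <+> pairs" "E \<subseteq> N"
    show "0 \<le> p N E" by (simp add: p_def)
    fix x assume x: "x \<in> (pairs <+> pairs) - N"
    have N': "finite (insert x N)" "insert x N \<subseteq> pairs <+> pairs"
      using N x by auto
    \<comment> \<open>The new point belongs to one of the two orders, and only the event of that order is cut in two.\<close>
    have "R.joint (A N E) (D N E) =
        R.joint (A (insert x N) E) (D (insert x N) E) +
        R.joint (A (insert x N) (insert x E)) (D (insert x N) (insert x E))"
    proof (cases x)
      case (Inl q)
      have v: "Inl -` insert x F = insert q (Inl -` F)" "Inr -` insert x F = Inr -` F" for F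
        using Inl by auto
      have "q \<notin> Inl -` N" "Inl -` E \<subseteq> Inl -` N" using x Inl N(3) by auto
      note split = ord.cyl_split[OF this]
      have "D (insert x N) E = D N E" "D (insert x N) (insert x E) = D N E"
        by (simp_all add: D_def v)
      moreover have "A N E = A (insert x N) E \<union> A (insert x N) (insert x E)"
        "A (insert x N) E \<inter> A (insert x N) (insert x E) = {}"
        using split unfolding A_def v by blast+
      ultimately show ?thesis
        using R.joint_Un_left[OF meas(1)[OF N'] meas(1)[OF N'] _ meas(2)[OF N(1,2)]] by simp
    next
      case (Inr q)
      have v: "Inr -` insert x F = insert q (Inr -` F)" "Inl -` insert x F = Inl -` F" for F
        using Inr by auto
      have "q \<notin> Inr -` N" "Inr -` E \<subseteq> Inr -` N" using x Inr N(3) by auto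
      note split = ord.cyl_split[OF this]
      have "A (insert x N) E = A N E" "A (insert x N) (insert x E) = A N E"
        by (simp_all add: A_def v)
      moreover have "D N E = D (insert x N) E \<union> D (insert x N) (insert x E)"
        "D (insert x N) E \<inter> D (insert x N) (insert x E) = {}"
        using split unfolding D_def v by blast+
      ultimately show ?thesis
        using R.joint_Un_right[OF meas(1)[OF N(1,2)] meas(2)[OF N'] meas(2)[OF N']] by simp
    qed
    then show "p N E = p (insert x N) E + p (insert x N) (insert x E)"
      using fin[OF N'] by (simp add: p_def enn2real_plus)
  qed
  moreover have "p N E = 0" if N: "finite N" "N \<subseteq> pairs <+> pairs" "E \<subseteq> N" and "pair.cyl N E = {}" for N E
  proof -
    have "ord.cyl (Inl -` N) (Inl -` E) \<times> ord.cyl (Inr -` N) (Inr -` E) \<subseteq> pair.cyl N E"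
      by (auto simp: ord.cyl_def pair.cyl_def Plus_Int_eq_iff)
    then have "A N E = {} \<or> D N E = {}"
      using that(4) by (auto simp: A_def D_def)
    then show ?thesis
      using R.joint_empty_left R.joint_empty_right by (auto simp: p_def)
  qed
  moreover have "p (translate_pair g ` N) (translate_pair g ` E) = p N E"
    if g: "g \<in> carrier G" and N: "finite N" "N \<subseteq> pairs <+> pairs" "E \<subseteq> N" for g N E
  proof -
    let ?a = "map_prod (r_act G g) (r_act G g)"
    have v: "Inl -` (translate_pair g ` F) = translate g ` (Inl -` F)"
      "Inr -` (translate_pair g ` F) = translate g ` (Inr -` F)" for F
      by (rule vimage_map_sum)+
    have cv: "r_act G g -` ord.cyl F F' \<inter> pOrd G = ord.cyl (translate g ` F) (translate g ` F')"
      if "F \<subseteq> pairs" "F' \<subseteq> F" for F F'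
      using ord.cyl_vimage[OF continuous_map_funspace[OF continuous_map_r_act[OF g]]
          translate_pairs(1,2)[OF g] mem_r_act_iff that] by simp
    have act: "r_act G g r \<in> pOrd G" if "r \<in> pOrd G" for r
      using r_act_in_pOrd[OF g that] .
    have "?a -` A N E \<inter> space \<mu>1 = (r_act G g -` ord.cyl (Inl -` N) (Inl -` E) \<inter> pOrd G) \<times> pOrd G"
      using act by (auto simp: A_def space)
    also have "\<dots> = A (translate_pair g ` N) (translate_pair g ` E)"
      by (simp only: A_def v cv[OF vimage(2)[OF N(1,2)] vimage_mono[OF N(3)]])
    finally have A': "?a -` A N E \<inter> space \<mu>1 = A (translate_pair g ` N) (translate_pair g ` E)" .
    have "?a -` D N E \<inter> space \<mu>2 = pOrd G \<times> (r_act G g -` ord.cyl (Inr -` N) (Inr -` E) \<inter> pOrd G)"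
      using act by (auto simp: D_def space)
    also have "\<dots> = D (translate_pair g ` N) (translate_pair g ` E)"
      by (simp only: D_def v cv[OF vimage(4)[OF N(1,2)] vimage_mono[OF N(3)]])
    finally have D': "?a -` D N E \<inter> space \<mu>2 = D (translate_pair g ` N) (translate_pair g ` E)" .
    have a: "?a \<in> measurable \<mu>1 \<mu>1" "?a \<in> measurable \<mu>2 \<mu>2"
      using continuous_map_measurable[OF continuous_map_r_act_pair[OF g]] sets
      by (simp_all cong: measurable_cong_sets)
    have law: "distr \<mu>1 \<mu>1 ?a = \<mu>1" "distr \<mu>2 \<mu>2 ?a = \<mu>2"
    proof -
      have "distr \<mu>1 \<mu>1 ?a = distr \<mu>1 (borel_space (pOrd_pair_topology G)) ?a"
        "distr \<mu>2 \<mu>2 ?a = distr \<mu>2 (borel_space (pOrd_pair_topology G)) ?a"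
        using sets by (auto intro!: distr_cong)
      then show "distr \<mu>1 \<mu>1 ?a = \<mu>1" "distr \<mu>2 \<mu>2 ?a = \<mu>2"
        using \<mu>1 \<mu>2 g by (simp_all add: joining_def)
    qed
    have "R.joint (?a -` A N E \<inter> space \<mu>1) (?a -` D N E \<inter> space \<mu>2) = R.joint (A N E) (D N E)"
      by (rule R.joint_invariant[OF a(1) law(1) a(2) law(2)
            continuous_map_measurable[OF continuous_map_r_act[OF g]]
            continuous_map_measurable[OF continuous_map_r_act[OF inv_closed[OF g]]]])
         (auto simp: r_act_inv[OF g] intro: meas[OF N(1,2)])
    then show ?thesis
      by (simp add: p_def A' D')
  qed
  moreover have "p {Inl q, Inr q} {Inl q} = 0" if q: "q \<in> pairs" for q
  proof -
    have Q: "ord.cyl {q} {q} = {r \<in> pOrd G. q \<in> r}" "ord.cyl {q} {} = {r \<in> pOrd G. q \<notin> r}"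
      by (auto simp: ord.cyl_def)
    have v: "Inl -` {Inl q, Inr q} = {q}" "Inr -` {Inl q, Inr q} = {q}" "Inl -` {Inl q} = {q}"
      "Inr -` {Inl q} = {}"
      by auto
    \<comment> \<open>A violation of nestedness at \<open>q\<close> occurs in \<open>\<mu>1\<close> or in \<open>\<mu>2\<close>, according to whether \<open>q\<close> is in the
      middle order.\<close>
    have null: "emeasure \<mu>1 {w \<in> pOrd G \<times> pOrd G. q \<in> fst w - snd w} = 0"
      "emeasure \<mu>2 {w \<in> pOrd G \<times> pOrd G. q \<in> fst w - snd w} = 0"
      using nested_iff_cyl[OF prob(1)] nested_iff_cyl[OF prob(2)] \<mu>1 \<mu>2 q
      unfolding joining_def pair_cyl_unnested R.M.emeasure_eq_measure R.M'.emeasure_eq_measure by auto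
    have "R.joint (A {Inl q, Inr q} {Inl q}) (D {Inl q, Inr q} {Inl q}) = 0"
    proof (rule R.joint_eq_zero)
      show "A {Inl q, Inr q} {Inl q} \<in> sets \<mu>1" "D {Inl q, Inr q} {Inl q} \<in> sets \<mu>2"
        by (intro meas Inl_Inr_subset q; simp)+
      show "ord.cyl {q} {q} \<in> sets ?B"
        using q by (intro ord.sets_cyl) auto
      have "A {Inl q, Inr q} {Inl q} \<inter> (snd -` (space ?B - ord.cyl {q} {q}) \<inter> space \<mu>1) =
          {w \<in> pOrd G \<times> pOrd G. q \<in> fst w - snd w}"
        by (auto simp: A_def v Q space)
      then show "emeasure \<mu>1 (A {Inl q, Inr q} {Inl q} \<inter> (snd -` (space ?B - ord.cyl {q} {q}) \<inter> space \<mu>1)) = 0"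
        using null(1) by simp
      have "D {Inl q, Inr q} {Inl q} \<inter> (fst -` ord.cyl {q} {q} \<inter> space \<mu>2) =
          {w \<in> pOrd G \<times> pOrd G. q \<in> fst w - snd w}"
        by (auto simp: D_def v Q space)
      then show "emeasure \<mu>2 (D {Inl q, Inr q} {Inl q} \<inter> (fst -` ord.cyl {q} {q} \<inter> space \<mu>2)) = 0"
        using null(2) by simp
    qed
    then show ?thesis by (simp add: p_def)
  qed
  ultimately have "joining_weights p"
    unfolding joining_weights_def by blast
  then obtain \<mu> where \<mu>: "joining \<mu>"
    and law: "\<And>N E. finite N \<Longrightarrow> N \<subseteq> pairs <+> pairs \<Longrightarrow> E \<subseteq> N \<Longrightarrow> measure \<mu> (pair.cyl N E) = p N E"
    by (rule joining_with_weights) blast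
  have \<mu>_prob: "borel_prob (pOrd_pair_topology G) \<mu>" using \<mu> by (simp add: joining_def)
  have "margin1 \<mu> = margin1 \<mu>1"
  proof (rule ord.measure_eq_of_cyl[OF borel_prob_margins(1)[OF \<mu>_prob] borel_prob_margins(1)[OF prob(1)]])
    fix N E assume N: "finite N" "N \<subseteq> pairs" "E \<subseteq> N"
    have v: "Inl -` Inl ` F = F" "Inr -` Inl ` F = {}" for F :: "'a rel" by auto
    have sub: "Inl ` N \<subseteq> pairs <+> pairs" using N(2) by auto
    have "measure (margin1 \<mu>) (ord.cyl N E) = p (Inl ` N) (Inl ` E)"
      using measure_margin_cyl(1)[OF \<mu>_prob N(1,2)] law[of "Inl ` N" "Inl ` E"] N sub
      by (simp add: image_mono)
    also have "\<dots> = enn2real (R.joint (pair.cyl (Inl ` N) (Inl ` E)) (space \<mu>2))"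
      by (simp add: p_def A_def D_def v cyl_empty space pair_cyl_Inl)
    also have "\<dots> = measure \<mu>1 (pair.cyl (Inl ` N) (Inl ` E))"
      using N sub by (subst R.joint_space_right) (auto intro!: pair.sets_cyl sets simp: measure_def)
    finally show "measure (margin1 \<mu>) (ord.cyl N E) = measure (margin1 \<mu>1) (ord.cyl N E)"
      using measure_margin_cyl(1)[OF prob(1) N(1,2)] by simp
  qed
  moreover have "margin2 \<mu> = margin2 \<mu>2"
  proof (rule ord.measure_eq_of_cyl[OF borel_prob_margins(2)[OF \<mu>_prob] borel_prob_margins(2)[OF prob(2)]])
    fix N E assume N: "finite N" "N \<subseteq> pairs" "E \<subseteq> N"
    have v: "Inr -` Inr ` F = F" "Inl -` Inr ` F = {}" for F :: "'a rel" by auto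
    have sub: "Inr ` N \<subseteq> pairs <+> pairs" using N(2) by auto
    have "measure (margin2 \<mu>) (ord.cyl N E) = p (Inr ` N) (Inr ` E)"
      using measure_margin_cyl(2)[OF \<mu>_prob N(1,2)] law[of "Inr ` N" "Inr ` E"] N sub
      by (simp add: image_mono)
    also have "\<dots> = enn2real (R.joint (space \<mu>1) (pair.cyl (Inr ` N) (Inr ` E)))"
      by (simp add: p_def A_def D_def v cyl_empty space pair_cyl_Inr)
    also have "\<dots> = measure \<mu>2 (pair.cyl (Inr ` N) (Inr ` E))"
      using N sub by (subst R.joint_space_left) (auto intro!: pair.sets_cyl sets simp: measure_def)
    finally show "measure (margin2 \<mu>) (ord.cyl N E) = measure (margin2 \<mu>2) (ord.cyl N E)"
      using measure_margin_cyl(2)[OF prob(2) N(1,2)] by simp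
  qed
  ultimately show ?thesis
    by (rule that[OF \<mu>])
qed

lemma ext_le_trans:
  assumes "ext_le G \<nu>1 \<nu>2" "ext_le G \<nu>2 \<nu>3"
  shows "ext_le G \<nu>1 \<nu>3"
  using assms joining_compose unfolding ext_le_iff by metis

end

section \<open>Joinings of maximal mass\<close>

context countable_group
begin

text \<open>
  The factors $2^{-n}$ only have to be positive and summable. For a finite group the
  enumeration repeats itself, so that each pair is counted several times.
\<close>

definition total_mass :: "'a rel measure \<Rightarrow> real" where
  "total_mass \<nu> = (\<Sum>n. (1/2) ^ n * measure \<nu> (ord.cyl {from_nat_into pairs n} {from_nat_into pairs n}))"

lemma from_nat_into_pairs: "from_nat_into pairs n \<in> pairs"
  using ord.index_nonempty by (rule from_nat_into)

lemma summable_halving_bounded: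
  assumes "\<And>n. \<bar>c n\<bar> \<le> (1::real)"
  shows "summable (\<lambda>n. (1/2) ^ n * c n)"
proof (rule summable_comparison_test')
  show "summable (\<lambda>n. (1/2::real) ^ n)" by (rule summable_geometric) simp
  show "norm ((1/2) ^ n * c n) \<le> (1/2) ^ n" for n
    using assms[of n] by (simp add: abs_mult mult_left_le)
qed

lemma closed_joining_weights:
  "closed {h :: (('a \<times> 'a) + ('a \<times> 'a)) set \<times> (('a \<times> 'a) + ('a \<times> 'a)) set \<Rightarrow> real.
     joining_weights (\<lambda>N E. h (N, E))}"
  unfolding joining_weights_def cylinder_weights_def Ball_def
  by (intro closed_Collect_conj closed_Collect_all closed_Collect_imp closed_Collect_eq
      closed_Collect_le open_Collect_const continuous_on_add continuous_on_const
      continuous_on_product_coordinates)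

text \<open>
  The families in $[0, 1]$ that restrict to the weights of a joining with first margin \<open>\<nu>\<close> form a
  closed, hence compact, set.
  The mass of the second margin is a uniform limit of finite sums of coordinates, hence
  continuous. The diagonal joining of \<open>\<nu>\<close> with itself shows that the set is not empty.
\<close>

lemma maximal_mass_joining:
  assumes \<nu>: "IRO G \<nu>"
  obtains \<mu> where "joining \<mu>" "margin1 \<mu> = \<nu>"
    "\<And>\<mu>'. joining \<mu>' \<Longrightarrow> margin1 \<mu>' = \<nu> \<Longrightarrow> total_mass (margin2 \<mu>') \<le> total_mass (margin2 \<mu>)"
proof -
  define K where "K = {h. (\<forall>x. h x \<in> {0..1::real}) \<and> joining_weights (\<lambda>N E. h (N, E)) \<and>
    (\<forall>N E. finite N \<and> N \<subseteq> pairs \<and> E \<subseteq> N \<longrightarrow> h (Inl ` N, Inl ` E) = measure \<nu> (ord.cyl N E))}"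
  define q where "q = from_nat_into pairs"
  define s where "s h = (\<Sum>n. (1/2) ^ n * h ({Inr (q n)}, {Inr (q n)}))"
    for h :: "(('a \<times> 'a) + ('a \<times> 'a)) set \<times> (('a \<times> 'a) + ('a \<times> 'a)) set \<Rightarrow> real"
  define w where "w \<mu> x = measure \<mu> (pair.cyl (fst x) (snd x))" for \<mu> x
  have \<nu>_prob: "borel_prob (pOrd_topology G) \<nu>" using \<nu> by (simp add: IRO_def)
  have w: "w \<mu> \<in> K" if "joining \<mu>" "margin1 \<mu> = \<nu>" for \<mu>
  proof -
    have \<mu>: "borel_prob (pOrd_pair_topology G) \<mu>" using that(1) by (simp add: joining_def)
    interpret prob_space \<mu> using \<mu> by (simp add: borel_prob_def)
    show ?thesis
      using joining_weights_joining[OF that(1)] measure_margin_cyl(1)[OF \<mu>] that(2)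
      by (auto simp: K_def w_def)
  qed
  have s_w: "s (w \<mu>) = total_mass (margin2 \<mu>)" if "joining \<mu>" for \<mu>
  proof -
    have \<mu>: "borel_prob (pOrd_pair_topology G) \<mu>" using that by (simp add: joining_def)
    have "{q n} \<subseteq> pairs" for n
      using from_nat_into_pairs by (simp add: q_def)
    then have "measure (margin2 \<mu>) (ord.cyl {q n} {q n}) = w \<mu> ({Inr (q n)}, {Inr (q n)})" for n
      using measure_margin_cyl(2)[OF \<mu>, of "{q n}" "{q n}"] by (simp add: w_def)
    then show ?thesis
      by (simp add: s_def total_mass_def q_def)
  qed
  \<comment> \<open>Tychonoff's theorem; all coordinates are confined to \<open>{0..1}\<close>, also those which are not weights of
    finite patterns.\<close>
  have "compact (Pi\<^sub>E UNIV (\<lambda>_. {0..1::real}) ::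
      ((('a \<times> 'a) + ('a \<times> 'a)) set \<times> (('a \<times> 'a) + ('a \<times> 'a)) set \<Rightarrow> real) set)"
    using compactin_PiE[of "\<lambda>_. euclidean" UNIV "\<lambda>_. {0..1::real}"]
    by (simp add: euclidean_product_topology compactin_euclidean_iff)
  moreover have "closed {h :: (('a \<times> 'a) + ('a \<times> 'a)) set \<times> (('a \<times> 'a) + ('a \<times> 'a)) set \<Rightarrow> real.
      \<forall>N E. finite N \<and> N \<subseteq> pairs \<and> E \<subseteq> N \<longrightarrow> h (Inl ` N, Inl ` E) = measure \<nu> (ord.cyl N E)}"
    by (intro closed_Collect_all closed_Collect_imp closed_Collect_eq open_Collect_const
        continuous_on_const continuous_on_product_coordinates)
  moreover have "K = Pi\<^sub>E UNIV (\<lambda>_. {0..1::real}) \<inter>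
      ({h. joining_weights (\<lambda>N E. h (N, E))} \<inter>
       {h. \<forall>N E. finite N \<and> N \<subseteq> pairs \<and> E \<subseteq> N \<longrightarrow> h (Inl ` N, Inl ` E) = measure \<nu> (ord.cyl N E)})"
    by (auto simp: K_def)
  ultimately have "compact K"
    using closed_joining_weights by (auto intro!: compact_Int_closed closed_Int)
  moreover obtain \<mu>0 where "joining \<mu>0" "margin1 \<mu>0 = \<nu>"
    by (rule joining_diagonal[OF \<nu>])
  then have "K \<noteq> {}"
    using w by blast
  moreover have "continuous_on K s"
  proof (rule uniform_limit_theorem)
    show "uniform_limit K (\<lambda>m h. \<Sum>n<m. (1/2) ^ n * h ({Inr (q n)}, {Inr (q n)})) s sequentially"
      unfolding s_def
    proof (rule Weierstrass_m_test)
      show "norm ((1/2) ^ n * h ({Inr (q n)}, {Inr (q n)})) \<le> (1/2::real) ^ n" if "h \<in> K" for n h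
        using that by (auto simp: K_def abs_mult intro!: mult_left_le)
    qed (rule summable_geometric, simp)
    show "\<forall>\<^sub>F m in sequentially. continuous_on K (\<lambda>h. \<Sum>n<m. (1/2) ^ n * h ({Inr (q n)}, {Inr (q n)}))"
      by (intro always_eventually allI continuous_on_sum continuous_on_mult continuous_on_const
          continuous_on_subset[OF continuous_on_product_coordinates subset_UNIV])
  qed simp
  ultimately obtain h where h: "h \<in> K" "\<And>h'. h' \<in> K \<Longrightarrow> s h' \<le> s h"
    using continuous_attains_sup[of K s] by blast
  then have "joining_weights (\<lambda>N E. h (N, E))" by (simp add: K_def)
  then obtain \<mu> where \<mu>: "joining \<mu>"
    and law: "\<And>N E. finite N \<Longrightarrow> N \<subseteq> pairs <+> pairs \<Longrightarrow> E \<subseteq> N \<Longrightarrow> measure \<mu> (pair.cyl N E) = h (N, E)"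
    by (rule joining_with_weights) blast
  have \<mu>_prob: "borel_prob (pOrd_pair_topology G) \<mu>" using \<mu> by (simp add: joining_def)
  have "margin1 \<mu> = \<nu>"
  proof (rule ord.measure_eq_of_cyl[OF borel_prob_margins(1)[OF \<mu>_prob] \<nu>_prob])
    fix N E assume N: "finite N" "N \<subseteq> pairs" "E \<subseteq> N"
    have "Inl ` N \<subseteq> pairs <+> pairs" using N(2) by auto
    then have "measure (margin1 \<mu>) (ord.cyl N E) = h (Inl ` N, Inl ` E)"
      using measure_margin_cyl(1)[OF \<mu>_prob N(1,2)] law[of "Inl ` N" "Inl ` E"] N
      by (simp add: image_mono)
    then show "measure (margin1 \<mu>) (ord.cyl N E) = measure \<nu> (ord.cyl N E)"
      using h(1) N by (simp add: K_def)
  qed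
  moreover have "total_mass (margin2 \<mu>') \<le> total_mass (margin2 \<mu>)"
    if "joining \<mu>'" "margin1 \<mu>' = \<nu>" for \<mu>'
  proof -
    have "s (w \<mu>) = s h"
    proof -
      have "Inr (q n) \<in> pairs <+> pairs" for n
        using from_nat_into_pairs[of n] unfolding q_def by (rule InrI)
      then show ?thesis using law by (simp add: s_def w_def)
    qed
    then show ?thesis
      using h(2)[OF w[OF that]] s_w[OF that(1)] s_w[OF \<mu>] by simp
  qed
  ultimately show ?thesis
    by (rule that[OF \<mu>])
qed

text \<open>
  Nestedness makes every summand of the second mass dominate that of the first, so the inequality of the
  masses forces equality term by term; and the difference of two nested events of equal probability is a
  null set.
\<close>

lemma joining_equal_mass:
  assumes \<mu>: "joining \<mu>" and le: "total_mass (margin2 \<mu>) \<le> total_mass (margin1 \<mu>)"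
  shows "margin2 \<mu> = margin1 \<mu>"
proof -
  have prob: "borel_prob (pOrd_pair_topology G) \<mu>" using \<mu> by (simp add: joining_def)
  interpret prob_space \<mu> using prob by (simp add: borel_prob_def)
  have space: "space \<mu> = pOrd G \<times> pOrd G" using borel_prob_space[OF prob] by simp
  define q where "q = from_nat_into pairs"
  define U where "U = (\<lambda>x. ord.cyl {x} {x})"
  have U: "U x = {r \<in> pOrd G. x \<in> r}" for x by (auto simp: U_def ord.cyl_def)
  have q: "{q n} \<subseteq> pairs" for n using from_nat_into_pairs by (simp add: q_def)
  have sets: "U x \<times> pOrd G \<in> sets \<mu>" "pOrd G \<times> U x \<in> sets \<mu>" if "x \<in> pairs" for x
  proof -
    have "Inl ` {x} \<subseteq> pairs <+> pairs" "Inr ` {x} \<subseteq> pairs <+> pairs" using that by auto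
    then show "U x \<times> pOrd G \<in> sets \<mu>" "pOrd G \<times> U x \<in> sets \<mu>"
      unfolding U_def pair_cyl_Inl[symmetric] pair_cyl_Inr[symmetric] using prob
      by (simp_all add: pair.sets_cyl borel_prob_def)
  qed
  have nested: "AE w in \<mu>. fst w \<subseteq> snd w"
    using \<mu> by (simp add: joining_def case_prod_beta)
  let ?a = "\<lambda>n. measure \<mu> (U (q n) \<times> pOrd G)" and ?b = "\<lambda>n. measure \<mu> (pOrd G \<times> U (q n))"
  have mass: "total_mass (margin1 \<mu>) = (\<Sum>n. (1/2) ^ n * ?a n)"
    "total_mass (margin2 \<mu>) = (\<Sum>n. (1/2) ^ n * ?b n)"
    using measure_margin_cyl[OF prob _ q]
    by (simp_all add: total_mass_def q_def[symmetric] U_def pair_cyl_Inl pair_cyl_Inr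
        del: image_insert image_empty)
  have sub: "AE w in \<mu>. w \<in> U x \<times> pOrd G \<longrightarrow> w \<in> pOrd G \<times> U x" for x
    using nested by eventually_elim (auto simp: U)
  have ab: "?a n \<le> ?b n" for n
    using sets[of "q n"] q by (intro finite_measure_mono_AE sub) auto
  have "(\<Sum>n. (1/2) ^ n * (?b n - ?a n)) = total_mass (margin2 \<mu>) - total_mass (margin1 \<mu>)"
    unfolding mass right_diff_distrib by (intro suminf_diff[symmetric] summable_halving_bounded) auto
  moreover have diff: "0 \<le> (1/2) ^ n * (?b n - ?a n)" for n
    using ab[of n] by simp
  moreover have summable: "summable (\<lambda>n. (1/2) ^ n * (?b n - ?a n))"
    unfolding right_diff_distrib by (intro summable_diff summable_halving_bounded) auto
  ultimately have "(\<Sum>n. (1/2) ^ n * (?b n - ?a n)) = 0"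
    using le suminf_nonneg[OF summable diff] by simp
  then have eq: "?b n = ?a n" for n
    using suminf_eq_zero_iff[OF summable diff] by simp
  have "AE w in \<mu>. x \<in> snd w \<longrightarrow> x \<in> fst w" if x: "x \<in> pairs" for x
  proof -
    obtain n where n: "x = q n"
      using x ord.countable_index by (metis from_nat_into_surj q_def)
    have "measure \<mu> (pOrd G \<times> U x - U x \<times> pOrd G) = measure \<mu> (pOrd G \<times> U x) - measure \<mu> (pOrd G \<times> U x \<inter> (U x \<times> pOrd G))"
      using sets[OF x] by (intro finite_measure_Diff') auto
    moreover have "measure \<mu> (pOrd G \<times> U x \<inter> (U x \<times> pOrd G)) = measure \<mu> (U x \<times> pOrd G)"
      using sub[of x] sets[OF x] by (intro finite_measure_eq_AE) auto
    ultimately have "emeasure \<mu> (pOrd G \<times> U x - U x \<times> pOrd G) = 0"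
      using eq[of n] n by (simp add: emeasure_eq_measure)
    then have "AE w in \<mu>. w \<notin> pOrd G \<times> U x - U x \<times> pOrd G"
      using sets[OF x] by (intro AE_not_in) (auto simp: null_sets_def)
    then show ?thesis
      by (rule AE_mp) (auto simp: U space intro!: AE_I2)
  qed
  then have "AE w in \<mu>. \<forall>x\<in>pairs. x \<in> snd w \<longrightarrow> x \<in> fst w"
    by (subst AE_ball_countable[OF ord.countable_index]) (rule ballI)
  then have "AE w in \<mu>. snd w = fst w"
    using nested AE_space
  proof eventually_elim
    case (elim w)
    then have "snd w \<in> topspace (pOrd_topology G)" by (auto simp: space)
    then show ?case using elim ord.coord_subset[of "snd w"] by auto
  qed
  then show ?thesis
    using measurable_margins[OF prob] by (intro distr_cong_AE) auto
qed

lemma exists_ext_maximal_above: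
  assumes \<nu>: "IRO G \<nu>"
  shows "\<exists>\<nu>'. IRO G \<nu>' \<and> ext_maximal G \<nu>' \<and> ext_le G \<nu> \<nu>'"
proof -
  obtain \<mu> where \<mu>: "joining \<mu>" "margin1 \<mu> = \<nu>"
    and max: "\<And>\<mu>'. joining \<mu>' \<Longrightarrow> margin1 \<mu>' = \<nu> \<Longrightarrow> total_mass (margin2 \<mu>') \<le> total_mass (margin2 \<mu>)"
    by (rule maximal_mass_joining[OF \<nu>]) (rule that)
  have le: "ext_le G \<nu> (margin2 \<mu>)"
    using \<mu> ext_le_iff by blast
  have "\<nu>'' = margin2 \<mu>" if ge: "ext_le G (margin2 \<mu>) \<nu>''" for \<nu>''
  proof -
    obtain \<eta> where \<eta>: "joining \<eta>" "margin1 \<eta> = margin2 \<mu>" "margin2 \<eta> = \<nu>''"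
      using ge ext_le_iff by blast
    obtain \<mu>' where "joining \<mu>'" "margin1 \<mu>' = \<nu>" "margin2 \<mu>' = \<nu>''"
      using ext_le_trans[OF le ge] ext_le_iff by blast
    then have "total_mass (margin2 \<eta>) \<le> total_mass (margin1 \<eta>)"
      using max \<eta> by metis
    then show ?thesis
      using joining_equal_mass[OF \<eta>(1)] \<eta> by simp
  qed
  then show ?thesis
    using le IRO_margins(2)[OF \<mu>(1)] by (auto simp: ext_maximal_def)
qed

end

theorem proposition1p1:
  fixes G :: "('a, 'b) monoid_scheme" and \<nu> :: "'a rel measure"
  assumes "group G" and "countable (carrier G)" and "IRO G \<nu>"
  shows "\<exists>\<nu>'. IRO G \<nu>' \<and> ext_maximal G \<nu>' \<and> ext_le G \<nu> \<nu>'"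
proof -
  interpret countable_group G
    using assms(1,2) by (intro countable_group.intro countable_group_axioms.intro)
  show ?thesis
    using assms(3) by (rule exists_ext_maximal_above)
qed

end
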